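(* Consider a market with $m+1$ assets (one risk-free cash asset and $m$ risky assets) observed over periods $t=1,2,\dots$. On period $t$ let $x_t\in\mathbb{R}^{m+1}_{+}$ be the price relative vector (ratio of closing price on period $t$ to closing price on period $t-1$, with $x_{t,0}=1$ for cash), and assume the process $(x_t)_t$ is stationary and ergodic. A portfolio policy chooses, on each period $t$, a portfolio vector $a_t$ in the simplex $\{a\in\mathbb{R}^{m+1}: a_i\ge 0,\ \sum_{i=0}^m a_i=1\}$ based on past information; its period return is $r_t=a_t^\top x_t$, there is no transaction cost, and its wealth after $t$ periods is $S_t=\prod_{s=1}^t r_s$ (initial wealth $1$). Let $\bar W^*=\lim_{t\to\infty}\frac1t\log \bar S^*_t$ be the growth rate of the log-optimal strategy, i.e. the policy maximizing the expected log-return $\mathbb{E}\{\log r_t\}$, with wealth $\bar S^*_t$. Let $\lambda\ge 0$ and let $S^*_t$ be the wealth achieved by the optimal portfolio policy that maximizes $\mathbb{E}\{\log r_t\}-\lambda\,\mathrm{Var}\{\log r_t\}$. Assume $\frac1e\le r_t\le e$. Then $$\bar W^*\ \ge\ \liminf_{t\to\infty}\frac1t\log S^*_t\ \ge\ \bar W^*-\frac94\lambda.$$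
   Context: Portfolio selection setting: the investor reallocates wealth among $m+1$ assets each period; the portfolio vector $a_t$ gives the proportion of wealth in each asset. Expectations and variances of $\log r_t$ are those of the period log-return under the stationary ergodic market process. The log-optimal strategy is the one maximizing $\mathbb{E}\{\log r_t\}$ and has the theoretical maximal growth rate $\bar W^*$ in this no-transaction-cost setting. *)

theory Defs
  imports "HOL-Probability.Probability"
begin

text \<open>Assets are indexed by a finite type 'n (so m+1 = CARD('n)); the cash asset is
  a distinguished index. Periods are indexed by nat starting at 0; the price relative
  vector of period t is X t, a random vector on the probability space M.\<close>

definition port_simplex :: "('n::finite \<Rightarrow> real) set" where
  "port_simplex = {a. (\<forall>i. 0 \<le> a i) \<and> sum a UNIV = 1}"

definition ret :: "('n::finite \<Rightarrow> real) \<Rightarrow> ('n \<Rightarrow> real) \<Rightarrow> real" where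
  "ret a x = (\<Sum>i\<in>UNIV. a i * x i)"

definition seq_space :: "(nat \<Rightarrow> 'n \<Rightarrow> real) measure" where
  "seq_space = (\<Pi>\<^sub>M t\<in>UNIV. (\<Pi>\<^sub>M i\<in>UNIV. borel))"

definition shift_seq :: "(nat \<Rightarrow> 'b) \<Rightarrow> nat \<Rightarrow> 'b" where
  "shift_seq x = (\<lambda>t. x (Suc t))"

definition stationary_ergodic :: "'a measure \<Rightarrow> (nat \<Rightarrow> 'a \<Rightarrow> 'n::finite \<Rightarrow> real) \<Rightarrow> bool" where
  "stationary_ergodic M X \<longleftrightarrow>
     distr M seq_space (\<lambda>\<omega>. shift_seq (\<lambda>t. X t \<omega>)) = distr M seq_space (\<lambda>\<omega>. \<lambda>t. X t \<omega>) \<and>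
     (\<forall>A \<in> sets seq_space. shift_seq -` A \<inter> space seq_space = A \<longrightarrow>
        measure M ((\<lambda>\<omega>. \<lambda>t. X t \<omega>) -` A \<inter> space M) \<in> {0, 1})"

definition past :: "'a measure \<Rightarrow> (nat \<Rightarrow> 'a \<Rightarrow> 'n::finite \<Rightarrow> real) \<Rightarrow> nat \<Rightarrow> 'a measure" where
  "past M X t = vimage_algebra (space M) (\<lambda>\<omega>. \<lambda>s\<in>{..<t}. X s \<omega>)
                  (\<Pi>\<^sub>M s\<in>{..<t}. (\<Pi>\<^sub>M i\<in>UNIV. borel))"

definition admissible_policy :: "'a measure \<Rightarrow> (nat \<Rightarrow> 'a \<Rightarrow> 'n::finite \<Rightarrow> real)
     \<Rightarrow> (nat \<Rightarrow> 'a \<Rightarrow> 'n \<Rightarrow> real) \<Rightarrow> bool" where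
  "admissible_policy M X A \<longleftrightarrow>
     (\<forall>t. (\<forall>\<omega>\<in>space M. A t \<omega> \<in> port_simplex) \<and> (\<forall>i. (\<lambda>\<omega>. A t \<omega> i) \<in> borel_measurable (past M X t)))"

definition cond_mean_log :: "'a measure \<Rightarrow> (nat \<Rightarrow> 'a \<Rightarrow> 'n::finite \<Rightarrow> real)
     \<Rightarrow> (nat \<Rightarrow> 'a \<Rightarrow> 'n \<Rightarrow> real) \<Rightarrow> nat \<Rightarrow> 'a \<Rightarrow> real" where
  "cond_mean_log M X A t = real_cond_exp M (past M X t) (\<lambda>\<omega>. ln (ret (A t \<omega>) (X t \<omega>)))"

definition cond_var_log :: "'a measure \<Rightarrow> (nat \<Rightarrow> 'a \<Rightarrow> 'n::finite \<Rightarrow> real)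
     \<Rightarrow> (nat \<Rightarrow> 'a \<Rightarrow> 'n \<Rightarrow> real) \<Rightarrow> nat \<Rightarrow> 'a \<Rightarrow> real" where
  "cond_var_log M X A t = (\<lambda>\<omega>.
     real_cond_exp M (past M X t) (\<lambda>\<omega>. (ln (ret (A t \<omega>) (X t \<omega>)))\<^sup>2) \<omega>
     - (cond_mean_log M X A t \<omega>)\<^sup>2)"

definition wealth :: "(nat \<Rightarrow> 'a \<Rightarrow> 'n::finite \<Rightarrow> real) \<Rightarrow> (nat \<Rightarrow> 'a \<Rightarrow> 'n \<Rightarrow> real)
     \<Rightarrow> nat \<Rightarrow> 'a \<Rightarrow> real" where
  "wealth X A n \<omega> = (\<Prod>s<n. ret (A s \<omega>) (X s \<omega>))"

definition log_optimal :: "'a measure \<Rightarrow> (nat \<Rightarrow> 'a \<Rightarrow> 'n::finite \<Rightarrow> real)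
     \<Rightarrow> (nat \<Rightarrow> 'a \<Rightarrow> 'n \<Rightarrow> real) \<Rightarrow> bool" where
  "log_optimal M X A \<longleftrightarrow> admissible_policy M X A \<and>
     (\<forall>B t. admissible_policy M X B \<longrightarrow>
        (AE \<omega> in M. cond_mean_log M X B t \<omega> \<le> cond_mean_log M X A t \<omega>))"

definition mv_optimal :: "'a measure \<Rightarrow> (nat \<Rightarrow> 'a \<Rightarrow> 'n::finite \<Rightarrow> real) \<Rightarrow> real
     \<Rightarrow> (nat \<Rightarrow> 'a \<Rightarrow> 'n \<Rightarrow> real) \<Rightarrow> bool" where
  "mv_optimal M X lam A \<longleftrightarrow> admissible_policy M X A \<and>
     (\<forall>B t. admissible_policy M X B \<longrightarrow>
        (AE \<omega> in M. cond_mean_log M X B t \<omega> - lam * cond_var_log M X B t \<omega>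
                    \<le> cond_mean_log M X A t \<omega> - lam * cond_var_log M X A t \<omega>))"

end

(* The proof stays on the one-sided sequence space and uses neither a two-sided extension
   of the price process nor an infinite-past optimal portfolio. Let L_n be the log wealth of
   the log-optimal policy and let W be the supremum over k of E[log r*_k].

   Any policy's log wealth is at most L_n + o(n), since the excess is a supermartingale with
   bounded increments; an exponential moment bound and Borel-Cantelli apply. Comparing with
   the policy that always uses the k-step optimal portfolio of the last k periods, whose
   growth rate is given by Birkhoff's theorem, yields liminf L_n / n >= W.

   For limsup L_n / n <= W, let Z_n be the sum, over all ways of restarting the log-optimal
   policy at some times in 1..n, of p^(number of restarts) times the resulting wealth. Then
   E[Z_n / S*_n] <= (1 + p)^n, so E[ln Z_n] <= n (W + p), while ln Z_n dominates
   L_j + ln p + (ln Z_(n-j) after j shifts). The covering argument of Katznelson and Weiss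
   for subadditive processes then bounds limsup L_n / n by W + p.

   Finally, mean-variance optimality bounds the conditional mean log return of the optimal
   policy from below by that of the log-optimal one minus (9/4) lambda, because the
   conditional variances differ by at most 2, and the supermartingale bound applies again. *)
theory Submission
  imports Defs
begin

section \<open>A maximal ergodic bound for approximately superadditive processes\<close>

text \<open>The obstacle is that in period \<open>t\<close> the log-optimal policy sees only
  \<open>t\<close> earlier prices, so its log returns are not the iterates of one function under the
  shift, and Birkhoff's or Kingman's theorem does not apply to them directly. Its log wealth is
  superadditive along restarts only up to an o(n) error that depends on the path, too weak for a
  covering argument that cuts an orbit many times. The mixture Z_n repairs this: whatever the cut
  points are, the wealth of the policy restarted there is already a summand, so each cut costs the
  constant - ln p on every path, which a long block absorbs. The price is (1 + p)^n, the total
  weight of all sets of restart times, hence a loss of rate ln (1 + p) <= p, which vanishes as p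
  tends to 0. Optimality is always tested against bounded nonnegative functions of the past, so
  conditional expectations appear only in the transfer from \<open>M\<close> to the sequence
  space.\<close>

lemma sum_lessThan_add:
  fixes f :: "nat \<Rightarrow> 'b::comm_monoid_add"
  shows "sum f {..<m + n} = sum f {..<m} + (\<Sum>i<n. f (m + i))"
  by (induction n) (simp_all add: add.assoc)

lemma funpow_add_swap: "(f ^^ (m + n)) x = (f ^^ n) ((f ^^ m) x)"
  by (subst add.commute) (simp add: funpow_add)

locale ergodic_system = prob_space +
  fixes T :: "'a \<Rightarrow> 'a"
  assumes T_measurable [measurable]: "T \<in> measurable M M"
    and T_preserves: "distr M M T = M"
    and T_ergodic: "\<And>A. A \<in> sets M \<Longrightarrow> T -` A \<inter> space M = A \<Longrightarrow> prob A \<in> {0, 1}"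
begin

section \<open>Iterates of a measure-preserving map and a zero-one law\<close>

lemma funpow_measurable [measurable]: "(T ^^ n) \<in> measurable M M"
  by (induction n) auto

lemma distr_funpow: "distr M M (T ^^ n) = M"
proof (induction n)
  case 0
  then show ?case by (simp add: distr_id id_def)
next
  case (Suc n)
  have "distr M M (T ^^ Suc n) = distr (distr M M (T ^^ n)) M T"
    by (subst distr_distr) auto
  then show ?case
    by (simp only: Suc T_preserves)
qed

lemma AE_funpow:
  assumes "AE x in M. Q x"
  shows "AE x in M. Q ((T ^^ n) x)"
  by (rule AE_distrD[OF funpow_measurable]) (simp only: distr_funpow assms)

lemma integral_funpow:
  fixes f :: "'a \<Rightarrow> real"
  assumes "f \<in> borel_measurable M"
  shows "(\<integral>x. f ((T ^^ n) x) \<partial>M) = (\<integral>x. f x \<partial>M)"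
  using integral_distr[OF funpow_measurable, of f n] assms distr_funpow[of n] by simp

text \<open>Ergodicity is given for exactly invariant sets. Since \<open>T\<close> preserves the
  measure, \<open>E\<close> and its preimage have equal probability, so inclusion up to a null set
  is equality up to a null set. The set of points that visit \<open>E\<close> infinitely often is
  then exactly invariant and agrees with \<open>E\<close> almost everywhere.\<close>

lemma quasi_invariant_zero_one:
  assumes E [measurable]: "E \<in> sets M"
    and sub: "AE x in M. T x \<in> E \<longrightarrow> x \<in> E"
  shows "prob E \<in> {0, 1}"
proof -
  have eq: "prob (T -` E \<inter> space M) = prob E"
    using measure_distr[OF T_measurable E] by (simp add: T_preserves)
  have "AE x in M. x \<notin> E - T -` E \<inter> space M"
  proof -
    have "prob (T -` E \<inter> space M) = prob (T -` E \<inter> space M \<inter> E)"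
      by (rule finite_measure_eq_AE) (use sub in auto)
    then have "prob (E - T -` E \<inter> space M) = 0"
      using finite_measure_Diff'[of E "T -` E \<inter> space M"] eq by (simp add: Int_commute)
    then show ?thesis
      by (intro AE_not_in) (auto simp: null_sets_def emeasure_eq_measure)
  qed
  then have "AE x in M. T x \<in> E \<longleftrightarrow> x \<in> E"
    using sub AE_space by eventually_elim auto
  then have "AE x in M. \<forall>m. (T ^^ Suc m) x \<in> E \<longleftrightarrow> (T ^^ m) x \<in> E"
    unfolding AE_all_countable
    using AE_funpow[of "\<lambda>x. T x \<in> E \<longleftrightarrow> x \<in> E"] by auto
  then have all: "AE x in M. \<forall>m. (T ^^ m) x \<in> E \<longleftrightarrow> x \<in> E"
  proof eventually_elim
    case (elim x)
    then have "(T ^^ m) x \<in> E \<longleftrightarrow> x \<in> E" for m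
      by (induction m) auto
    then show ?case by simp
  qed
  define E' where "E' = {x \<in> space M. \<forall>k. \<exists>m\<ge>k. (T ^^ m) x \<in> E}"
  have [measurable]: "E' \<in> sets M"
    unfolding E'_def by measurable
  have "T -` E' \<inter> space M = E'"
  proof -
    have "(\<forall>k. \<exists>m\<ge>k. (T ^^ m) (T x) \<in> E) \<longleftrightarrow> (\<forall>k. \<exists>m\<ge>k. (T ^^ m) x \<in> E)" for x
    proof -
      have "(\<exists>m\<ge>k. (T ^^ m) (T x) \<in> E) \<longleftrightarrow> (\<exists>m\<ge>Suc k. (T ^^ m) x \<in> E)" for k
      proof
        assume "\<exists>m\<ge>k. (T ^^ m) (T x) \<in> E"
        then obtain m where "m \<ge> k" "(T ^^ m) (T x) \<in> E" by blast
        then show "\<exists>m\<ge>Suc k. (T ^^ m) x \<in> E"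
          by (intro exI[of _ "Suc m"]) (simp add: funpow_swap1)
      next
        assume "\<exists>m\<ge>Suc k. (T ^^ m) x \<in> E"
        then obtain m where "m \<ge> Suc k" "(T ^^ m) x \<in> E" by blast
        then show "\<exists>m\<ge>k. (T ^^ m) (T x) \<in> E"
          by (cases m) (auto simp: funpow_swap1)
      qed
      moreover have "(\<forall>k. \<exists>m\<ge>Suc k. (T ^^ m) x \<in> E) \<longleftrightarrow> (\<forall>k. \<exists>m\<ge>k. (T ^^ m) x \<in> E)"
        by (meson Suc_leD le_Suc_eq order_refl order_trans)
      ultimately show ?thesis by simp
    qed
    then show ?thesis
      unfolding E'_def using measurable_space[OF T_measurable] by auto
  qed
  then have "prob E' \<in> {0, 1}"
    by (rule T_ergodic[rotated]) simp
  moreover have "AE x in M. x \<in> E' \<longleftrightarrow> x \<in> E"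
    using all AE_space by eventually_elim (auto simp: E'_def)
  then have "prob E' = prob E"
    by (rule finite_measure_eq_AE) auto
  ultimately show ?thesis by simp
qed

text \<open>Katznelson--Weiss covering: cut the orbit greedily into blocks of length at most \<open>k\<close> on which
  \<open>a\<close> grows at rate about \<open>c\<close>; points starting no such block form the small set \<open>G k\<close> and become
  blocks of length one.\<close>

lemma covering_lower_bound:
  fixes a V :: "nat \<Rightarrow> 'a \<Rightarrow> real"
  assumes [measurable]: "\<And>n. a n \<in> borel_measurable M"
    and V_int: "\<And>n. integrable M (V n)"
    and freq: "AE x in M. \<exists>\<^sub>F n in sequentially. c * real n < a n x"
    and super: "\<And>n j x. x \<in> space M \<Longrightarrow> 1 \<le> j \<Longrightarrow> j \<le> n \<Longrightarrow> a j x - \<kappa> + V (n - j) ((T ^^ j) x) \<le> V n x"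
    and V_ge: "\<And>n x. x \<in> space M \<Longrightarrow> - (C * real n) \<le> V n x"
    and a_ge: "\<And>x. x \<in> space M \<Longrightarrow> - C \<le> a 1 x"
    and C: "0 \<le> C" and \<kappa>: "0 \<le> \<kappa>" and \<epsilon>: "0 < \<epsilon>"
  obtains K where "\<And>n. real n * (c - \<epsilon>) - K \<le> (\<integral>x. V n x \<partial>M)"
proof -
  \<comment> \<open>Half of \<epsilon> pays for \<kappa> on a long block, the other half for the
    visits to \<open>G k\<close>. \<open>D\<close> bounds the loss on a block of length one, c' - (-
    C - \<kappa>), and also the loss per unit of time on the last, incomplete block.\<close>
  define c' where "c' = c - \<epsilon> / 2"
  define D where "D = \<bar>c'\<bar> + C + \<kappa>"
  have D: "0 \<le> D" using C \<kappa> by (simp add: D_def)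
  define good where "good j x \<longleftrightarrow> 1 \<le> j \<and> c' * real j \<le> a j x - \<kappa>" for j x
  define G where "G k = {x \<in> space M. \<forall>j\<le>k. \<not> good j x}" for k
  have [measurable]: "G k \<in> sets M" for k
    unfolding G_def good_def by measurable
  \<comment> \<open>\<open>freq\<close> supplies arbitrarily large \<open>j\<close>, in particular
    one beyond 2 * \<kappa> / \<epsilon>, where \<epsilon> / 2 * j absorbs \<kappa>. So almost every
    point starts a good block of some length.\<close>
  have "AE x in M. x \<notin> (\<Inter>k. G k)"
    using freq AE_space
  proof eventually_elim
    case (elim x)
    obtain j0 :: nat where j0: "2 * \<kappa> / \<epsilon> \<le> real j0"
      using real_arch_simple by blast
    obtain j where j: "Suc j0 \<le> j" "c * real j < a j x"
      using elim(1) by (auto simp: frequently_sequentially)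
    have "\<kappa> \<le> \<epsilon> / 2 * real j"
    proof -
      have "2 * \<kappa> / \<epsilon> \<le> real j"
        using j0 j(1) by simp
      then show ?thesis
        using \<epsilon> by (simp add: field_simps)
    qed
    then have "good j x"
      using j by (simp add: good_def c'_def algebra_simps)
    then show ?case
      by (auto simp: G_def)
  qed
  then have "prob (\<Inter>k. G k) = 0"
    by (subst prob_eq_0) auto
  moreover have "(\<lambda>k. prob (G k)) \<longlonglongrightarrow> prob (\<Inter>k. G k)"
  proof (rule finite_Lim_measure_decseq)
    show "range G \<subseteq> events" by auto
    show "decseq G"
    proof (rule decseq_SucI)
      show "G (Suc k) \<subseteq> G k" for k
        unfolding G_def using le_SucI by blast
    qed
  qed
  ultimately have "(\<lambda>k. D * prob (G k)) \<longlonglongrightarrow> D * 0"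
    by (intro tendsto_intros) simp
  then have "\<forall>\<^sub>F k in sequentially. D * prob (G k) < \<epsilon> / 2"
    using \<epsilon> by (intro order_tendstoD(2)) auto
  then obtain k where k: "D * prob (G k) < \<epsilon> / 2"
    by (auto simp: eventually_sequentially)
  have T_space: "(T ^^ j) x \<in> space M" if "x \<in> space M" for j x
    using measurable_space[OF funpow_measurable that] .
  \<comment> \<open>Strong induction on \<open>n\<close>: remove a good block of length at most
    \<open>k\<close>, or a single step at cost \<open>D\<close> if the orbit is in
    \<open>G k\<close>. The term \<open>D * real k\<close> pays for the remainder once
    \<open>n \<le> k\<close>.\<close>
  have pointwise: "real n * c' - D * (\<Sum>i<n. indicator (G k) ((T ^^ i) x)) - D * real k \<le> V n x"
    if "x \<in> space M" for n x
    using that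
  proof (induction n arbitrary: x rule: less_induct)
    case (less n)
    let ?s = "\<lambda>n x. \<Sum>i<n. indicator (G k) ((T ^^ i) x) :: real"
    have s_nonneg: "0 \<le> ?s n x" for n x
      by (intro sum_nonneg) auto
    have s_split: "?s n x = ?s j x + ?s (n - j) ((T ^^ j) x)" if "j \<le> n" for j
    proof -
      have "?s (j + (n - j)) x = ?s j x + (\<Sum>i<n - j. indicator (G k) ((T ^^ (j + i)) x))"
        by (rule sum_lessThan_add)
      then show ?thesis
        using that by (simp add: funpow_add_swap)
    qed
    show ?case
    proof (cases "n \<le> k")
      case True
      have "real n * c' + C * real n \<le> D * real n"
      proof -
        have "(c' + C) * real n \<le> D * real n"
          using \<kappa> by (intro mult_right_mono) (auto simp: D_def)
        then show ?thesis by (simp add: algebra_simps)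
      qed
      also have "\<dots> \<le> D * real k"
        using True D by (intro mult_left_mono) auto
      finally show ?thesis
        using V_ge[OF less.prems, of n] mult_nonneg_nonneg[OF D s_nonneg[of x n]] by linarith
    next
      case False
      show ?thesis
      proof (cases "x \<in> G k")
        case True
        have *: "1 \<le> n" using False by simp
        have "real (n - 1) * c' - D * ?s (n - 1) ((T ^^ 1) x) - D * real k \<le> V (n - 1) ((T ^^ 1) x)"
          using False by (intro less.IH T_space less.prems) auto
        moreover have "?s n x = 1 + ?s (n - 1) ((T ^^ 1) x)"
          using s_split[OF *] True by simp
        ultimately show ?thesis
          using super[OF less.prems order_refl *] a_ge[OF less.prems] * abs_ge_self[of c']
          by (simp add: of_nat_diff algebra_simps D_def)
      next
        case 2: False
        then obtain j where j: "j \<le> k" "good j x"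
          using less.prems by (auto simp: G_def)
        have jn: "1 \<le> j" "j \<le> n" using j False by (auto simp: good_def)
        have "real (n - j) * c' - D * ?s (n - j) ((T ^^ j) x) - D * real k \<le> V (n - j) ((T ^^ j) x)"
          using jn by (intro less.IH T_space less.prems) auto
        moreover have "D * ?s (n - j) ((T ^^ j) x) \<le> D * ?s n x"
          unfolding s_split[OF jn(2)] using D s_nonneg[of x j] by (intro mult_left_mono) auto
        moreover have "c' * real j \<le> a j x - \<kappa>"
          using j by (simp add: good_def)
        ultimately show ?thesis
          using super[OF less.prems jn] jn by (simp add: of_nat_diff algebra_simps)
      qed
    qed
  qed
  have "real n * (c - \<epsilon>) - D * real k \<le> (\<integral>x. V n x \<partial>M)" for n
  proof -
    have ind: "integrable M (\<lambda>x. indicator (G k) ((T ^^ i) x) :: real)" for i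
      by (rule integrable_const_bound[where B=1]) auto
    have "(\<integral>x. indicator (G k) ((T ^^ i) x) \<partial>M) = prob (G k)" for i
      by (subst integral_funpow) auto
    then have "(\<integral>x. real n * c' - D * (\<Sum>i<n. indicator (G k) ((T ^^ i) x)) - D * real k \<partial>M)
        = real n * c' - D * (real n * prob (G k)) - D * real k"
      using ind by (simp add: prob_space Bochner_Integration.integral_diff Bochner_Integration.integrable_sum)
    moreover have "(\<integral>x. real n * c' - D * (\<Sum>i<n. indicator (G k) ((T ^^ i) x)) - D * real k \<partial>M) \<le> (\<integral>x. V n x \<partial>M)"
      using ind V_int by (intro integral_mono pointwise) auto
    moreover have "D * (real n * prob (G k)) \<le> real n * (\<epsilon> / 2)"
      using mult_left_mono[OF less_imp_le[OF k], of "real n"] by (simp add: mult.left_commute)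
    ultimately show ?thesis
      by (simp add: c'_def algebra_simps)
  qed
  then show thesis by (rule that)
qed

text \<open>\<open>a\<close> carries the pointwise claim, \<open>V\<close> the control of
  expectations. By \<open>quasi\<close> the set where limsup a n / n exceeds c is invariant up to
  null sets, hence null or of full measure. If it were full for some c > w, the covering bound would
  make the expectation of \<open>V n\<close> outgrow n * w.\<close>

lemma ergodic_upper_bound:
  fixes a V :: "nat \<Rightarrow> 'a \<Rightarrow> real"
  assumes [measurable]: "\<And>n. a n \<in> borel_measurable M"
    and V_int: "\<And>n. integrable M (V n)"
    and quasi: "AE x in M. \<forall>\<epsilon>>0. \<forall>\<^sub>F n in sequentially. a n (T x) \<le> a (Suc n) x + \<epsilon> * real n"
    and super: "\<And>n j x. x \<in> space M \<Longrightarrow> 1 \<le> j \<Longrightarrow> j \<le> n \<Longrightarrow> a j x - \<kappa> + V (n - j) ((T ^^ j) x) \<le> V n x"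
    and V_ge: "\<And>n x. x \<in> space M \<Longrightarrow> - (C * real n) \<le> V n x"
    and a_ge: "\<And>x. x \<in> space M \<Longrightarrow> - C \<le> a 1 x"
    and C: "0 \<le> C" and \<kappa>: "0 \<le> \<kappa>"
    and V_le: "\<And>n. (\<integral>x. V n x \<partial>M) \<le> real n * w"
  shows "AE x in M. \<forall>\<epsilon>>0. \<forall>\<^sub>F n in sequentially. a n x \<le> (w + \<epsilon>) * real n"
proof -
  \<comment> \<open>This encodes limsup a n / n > c. The margin 1 / (m + 1) keeps the quantifiers
    countable and leaves room for the errors in the invariance proof.\<close>
  define E where "E c = {x \<in> space M. \<exists>m. \<forall>k. \<exists>n\<ge>k. (c + 1 / real (Suc m)) * real n < a n x}" for c
  have [measurable]: "E c \<in> sets M" for c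
    unfolding E_def by measurable
  have inv: "AE x in M. T x \<in> E c \<longrightarrow> x \<in> E c" for c
    using quasi AE_space
  proof eventually_elim
    case (elim x)
    show ?case
    proof
      assume "T x \<in> E c"
      then obtain m where m: "\<And>k. \<exists>n\<ge>k. (c + 1 / real (Suc m)) * real n < a n (T x)"
        by (auto simp: E_def)
      define \<delta> where "\<delta> = 1 / real (Suc m)"
      \<comment> \<open>Half of the margin survives: a quarter of \<delta> absorbs the error in
        \<open>quasi\<close>, another quarter the change from \<open>n\<close> to
        \<open>Suc n\<close>. The surviving half is the margin with index
        \<open>2 * m + 1\<close>.\<close>
      define d where "d = c + \<delta> / 2"
      have \<delta>: "0 < \<delta>" by (simp add: \<delta>_def)
      obtain k0 where k0: "\<And>n. k0 \<le> n \<Longrightarrow> a n (T x) \<le> a (Suc n) x + \<delta> / 4 * real n"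
        using elim(1)[rule_format, of "\<delta> / 4"] \<delta> by (auto simp: eventually_sequentially)
      obtain k1 :: nat where k1: "4 * \<bar>d\<bar> / \<delta> \<le> real k1"
        using real_arch_simple by blast
      have "\<exists>n\<ge>k. (c + 1 / real (Suc (2 * m + 1))) * real n < a n x" for k
      proof -
        obtain n where n: "max k (max k0 k1) \<le> n" "(c + \<delta>) * real n < a n (T x)"
          using m[of "max k (max k0 k1)"] by (auto simp: \<delta>_def)
        have "4 * \<bar>d\<bar> / \<delta> \<le> real n"
          using k1 n(1) by (meson dual_order.trans max.boundedE of_nat_mono)
        then have "\<bar>d\<bar> \<le> \<delta> / 4 * real n"
          using \<delta> by (simp add: field_simps)
        moreover have "d \<le> \<bar>d\<bar>" by simp
        ultimately have "d * real n + d \<le> d * real n + \<delta> / 4 * real n" by linarith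
        then have "d * real (Suc n) \<le> (c + \<delta>) * real n - \<delta> / 4 * real n"
          by (simp add: d_def field_simps)
        also have "\<dots> < a (Suc n) x"
          using k0[of n] n by auto
        finally have "d * real (Suc n) < a (Suc n) x" .
        moreover have "d = c + 1 / real (Suc (2 * m + 1))"
          by (simp add: d_def \<delta>_def field_simps)
        ultimately show ?thesis
          using n(1) by (intro exI[of _ "Suc n"]) auto
      qed
      then show "x \<in> E c"
        using elim(2) unfolding E_def by blast
    qed
  qed
  have null: "AE x in M. x \<notin> E c" if c: "w < c" for c
  proof -
    have "prob (E c) \<noteq> 1"
    proof
      assume "prob (E c) = 1"
      then have "AE x in M. x \<in> E c"
        by (subst (asm) prob_eq_1) auto
      then have freq: "AE x in M. \<exists>\<^sub>F n in sequentially. c * real n < a n x"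
      proof eventually_elim
        case (elim x)
        then obtain m where m: "\<And>k. \<exists>n\<ge>k. (c + 1 / real (Suc m)) * real n < a n x"
          by (auto simp: E_def)
        show ?case
          unfolding frequently_sequentially
        proof
          fix k
          obtain n where "n \<ge> k" "(c + 1 / real (Suc m)) * real n < a n x"
            using m by blast
          then show "\<exists>n\<ge>k. c * real n < a n x"
            by (intro exI[of _ n]) (auto simp: algebra_simps intro: le_less_trans[rotated])
        qed
      qed
      define \<epsilon> where "\<epsilon> = (c - w) / 2"
      have \<epsilon>: "0 < \<epsilon>" using c by (simp add: \<epsilon>_def)
      obtain K where K: "\<And>n. real n * (c - \<epsilon>) - K \<le> (\<integral>x. V n x \<partial>M)"
        using covering_lower_bound[OF assms(1) V_int freq super V_ge a_ge C \<kappa> \<epsilon>] by blast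
      obtain n :: nat where n: "K / \<epsilon> < real n"
        using reals_Archimedean2 by blast
      have "real n * (c - \<epsilon>) - K \<le> real n * w"
        using K[of n] V_le[of n] by linarith
      then have "real n * \<epsilon> \<le> K"
        by (simp add: \<epsilon>_def field_simps)
      then show False
        using n \<epsilon> by (simp add: field_simps)
    qed
    then have "prob (E c) = 0"
      using quasi_invariant_zero_one[OF _ inv[of c]] by auto
    then show ?thesis
      by (subst (asm) prob_eq_0) auto
  qed
  have "AE x in M. \<forall>m. x \<notin> E (w + 1 / real (Suc m))"
    unfolding AE_all_countable by (intro allI null) simp
  then show ?thesis
    using AE_space
  proof eventually_elim
    case (elim x)
    show ?case
    proof (intro allI impI)
      fix \<epsilon> :: real assume "0 < \<epsilon>"
      then obtain m where m: "1 / real (Suc m) < \<epsilon> / 2"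
        using reals_Archimedean[of "\<epsilon> / 2"] by (auto simp: inverse_eq_divide)
      have "\<exists>k. \<forall>n\<ge>k. a n x \<le> (w + 1 / real (Suc m) + 1 / real (Suc m)) * real n"
        using elim unfolding E_def mem_Collect_eq not_less[symmetric] by blast
      then obtain k where k: "\<And>n. k \<le> n \<Longrightarrow> a n x \<le> (w + 1 / real (Suc m) + 1 / real (Suc m)) * real n"
        by blast
      have "(w + 1 / real (Suc m) + 1 / real (Suc m)) * real n \<le> (w + \<epsilon>) * real n" for n
        using m by (intro mult_right_mono) auto
      then show "\<forall>\<^sub>F n in sequentially. a n x \<le> (w + \<epsilon>) * real n"
        unfolding eventually_sequentially using k order_trans by blast
    qed
  qed
qed

text \<open>The sums of - f along orbits are exactly additive, so they serve both as
  \<open>a\<close> and as \<open>V\<close>, with \<kappa> = 0. An upper bound for them is the lower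
  bound for f.\<close>

lemma birkhoff_lower_bound:
  fixes f :: "'a \<Rightarrow> real"
  assumes [measurable]: "f \<in> borel_measurable M"
    and bnd: "\<And>x. x \<in> space M \<Longrightarrow> \<bar>f x\<bar> \<le> C"
  shows "AE x in M. \<forall>\<epsilon>>0. \<forall>\<^sub>F n in sequentially.
    ((\<integral>x. f x \<partial>M) - \<epsilon>) * real n \<le> (\<Sum>i<n. f ((T ^^ i) x))"
proof -
  define a where "a n x = (\<Sum>i<n. - f ((T ^^ i) x))" for n x
  have T_space: "(T ^^ j) x \<in> space M" if "x \<in> space M" for j x
    using measurable_space[OF funpow_measurable that] .
  obtain y where "y \<in> space M" using not_empty by blast
  from bnd[OF this] have C: "0 \<le> C" by linarith
  have [measurable]: "a n \<in> borel_measurable M" for n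
    unfolding a_def by measurable
  have f_int: "integrable M (\<lambda>x. f ((T ^^ i) x))" for i
    by (rule integrable_const_bound[where B=C]) (auto intro!: AE_I2 bnd T_space)
  have a_le: "\<bar>a n x\<bar> \<le> C * real n" if "x \<in> space M" for n x
  proof -
    have "\<bar>a n x\<bar> \<le> (\<Sum>i<n. \<bar>- f ((T ^^ i) x)\<bar>)"
      unfolding a_def by (rule sum_abs)
    also have "\<dots> \<le> (\<Sum>i<n. C)"
      by (intro sum_mono) (simp add: bnd T_space that)
    finally show ?thesis by (simp add: mult.commute)
  qed
  have a_Suc: "a (Suc n) x = - f x + a n (T x)" for n x
    by (simp only: a_def sum.lessThan_Suc_shift) (simp add: funpow_swap1)
  have a_add: "a (j + m) x = a j x + a m ((T ^^ j) x)" for j m x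
    unfolding a_def by (subst sum_lessThan_add) (simp add: funpow_add_swap)
  have "AE x in M. \<forall>\<epsilon>>0. \<forall>\<^sub>F n in sequentially. a n x \<le> (- (\<integral>x. f x \<partial>M) + \<epsilon>) * real n"
  proof (rule ergodic_upper_bound[where V=a and \<kappa>=0 and C=C])
    show "AE x in M. \<forall>\<epsilon>>0. \<forall>\<^sub>F n in sequentially. a n (T x) \<le> a (Suc n) x + \<epsilon> * real n"
      using AE_space
    proof eventually_elim
      case (elim x)
      show ?case
      proof (intro allI impI)
        fix \<epsilon> :: real assume \<epsilon>: "0 < \<epsilon>"
        obtain k :: nat where k: "C / \<epsilon> \<le> real k"
          using real_arch_simple by blast
        have "a n (T x) \<le> a (Suc n) x + \<epsilon> * real n" if "k \<le> n" for n
        proof -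
          have "C / \<epsilon> \<le> real n" using k that by linarith
          then have "C \<le> \<epsilon> * real n" using \<epsilon> by (simp add: field_simps)
          then show ?thesis using a_Suc[of n x] bnd[OF elim] by linarith
        qed
        then show "\<forall>\<^sub>F n in sequentially. a n (T x) \<le> a (Suc n) x + \<epsilon> * real n"
          unfolding eventually_sequentially by blast
      qed
    qed
    show "a j x - 0 + a (n - j) ((T ^^ j) x) \<le> a n x" if "1 \<le> j" "j \<le> n" for n j x
      using a_add[of j "n - j" x] that by simp
    show "- (C * real n) \<le> a n x" if "x \<in> space M" for n x
      using a_le[OF that, of n] by linarith
    show "- C \<le> a 1 x" if "x \<in> space M" for x
      using a_le[OF that, of 1] by simp
    show "integrable M (a n)" for n
      by (rule integrable_const_bound[where B="C * real n"]) (auto intro!: AE_I2 a_le)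
    show "(\<integral>x. a n x \<partial>M) \<le> real n * - (\<integral>x. f x \<partial>M)" for n
      using f_int by (simp add: a_def integral_funpow sum_negf)
  qed (use C in auto)
  then show ?thesis
    by eventually_elim
      (auto simp: a_def sum_negf algebra_simps elim!: eventually_mono)
qed

end

section \<open>Policies on the sequence space\<close>

lemma space_seq_space [simp]: "space seq_space = UNIV"
  by (simp add: seq_space_def space_PiM)

lemma seq_space_component [measurable]:
  "(\<lambda>x. x t i) \<in> borel_measurable (seq_space :: (nat \<Rightarrow> 'n \<Rightarrow> real) measure)"
proof -
  have "(\<lambda>x. x t) \<in> measurable seq_space (\<Pi>\<^sub>M i\<in>(UNIV::'n set). (borel::real measure))"
    unfolding seq_space_def by (rule measurable_component_singleton) simp
  then show ?thesis
    by (rule measurable_compose) (rule measurable_component_singleton, simp)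
qed

lemma measurable_into_seq_space:
  assumes "\<And>t i. (\<lambda>x. f x t i) \<in> borel_measurable N"
  shows "f \<in> measurable N seq_space"
proof -
  have "(\<lambda>x. f x t) \<in> measurable N (\<Pi>\<^sub>M i\<in>UNIV. borel)" for t
    using measurable_abs_UNIV[of "\<lambda>i x. f x t i", OF assms] .
  then show ?thesis
    unfolding seq_space_def by (rule measurable_abs_UNIV[of "\<lambda>t x. f x t"])
qed

lemma funpow_shift_seq: "(shift_seq ^^ k) x = (\<lambda>t. x (t + k))"
  by (induction k) (simp_all add: shift_seq_def)

lemma measurable_funpow_shift [measurable]: "(shift_seq ^^ k) \<in> measurable seq_space seq_space"
  unfolding funpow_shift_seq[abs_def]
  by (rule measurable_into_seq_space) (rule seq_space_component)

text \<open>Clipping prices to the interval forced by the return bounds makes the bounds hold on the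
  whole sequence space instead of almost everywhere; it has no effect on actual price paths.\<close>

definition clip :: "real \<Rightarrow> real" where
  "clip v = max (exp (-1)) (min (exp 1) v)"

section \<open>Log returns, non-anticipating functions and causal policies\<close>

definition log_ret :: "(nat \<Rightarrow> (nat \<Rightarrow> 'n::finite \<Rightarrow> real) \<Rightarrow> 'n \<Rightarrow> real)
    \<Rightarrow> nat \<Rightarrow> (nat \<Rightarrow> 'n \<Rightarrow> real) \<Rightarrow> real" where
  "log_ret \<beta> t x = ln (ret (\<beta> t x) (\<lambda>i. clip (x t i)))"

definition log_wealth :: "(nat \<Rightarrow> (nat \<Rightarrow> 'n::finite \<Rightarrow> real) \<Rightarrow> 'n \<Rightarrow> real)
    \<Rightarrow> nat \<Rightarrow> (nat \<Rightarrow> 'n \<Rightarrow> real) \<Rightarrow> real" where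
  "log_wealth \<beta> n x = (\<Sum>t<n. log_ret \<beta> t x)"

text \<open>Together with Borel measurability this stands for measurability with respect to
  \<open>past\<close> (see \<open>past_measurable\<close>). Stated through coordinates, it passes
  directly to shifted paths and recombined policies.\<close>

definition nonanticipating :: "nat \<Rightarrow> ((nat \<Rightarrow> 'b) \<Rightarrow> 'c) \<Rightarrow> bool" where
  "nonanticipating t f \<longleftrightarrow> (\<forall>x y. (\<forall>s<t. x s = y s) \<longrightarrow> f x = f y)"

lemma nonanticipatingD: "nonanticipating t f \<Longrightarrow> (\<And>s. s < t \<Longrightarrow> x s = y s) \<Longrightarrow> f x = f y"
  unfolding nonanticipating_def by blast

lemma nonanticipating_compose2:
  assumes "nonanticipating t f" "nonanticipating t g"
  shows "nonanticipating t (\<lambda>x. h (f x) (g x))"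
  unfolding nonanticipating_def
proof (intro allI impI)
  fix x y :: "nat \<Rightarrow> 'a" assume "\<forall>s<t. x s = y s"
  then have "f x = f y" "g x = g y"
    using assms unfolding nonanticipating_def by blast+
  then show "h (f x) (g x) = h (f y) (g y)" by simp
qed

definition causal_policy :: "(nat \<Rightarrow> (nat \<Rightarrow> 'n::finite \<Rightarrow> real) \<Rightarrow> 'n \<Rightarrow> real) \<Rightarrow> bool" where
  "causal_policy \<beta> \<longleftrightarrow> (\<forall>t. (\<forall>x. \<beta> t x \<in> port_simplex) \<and>
     (\<forall>i. (\<lambda>x. \<beta> t x i) \<in> borel_measurable seq_space) \<and> nonanticipating t (\<beta> t))"

text \<open>These are test functions: an inequality between conditional means given the first
  \<open>t\<close> periods is used in integrated form, against all such functions.\<close>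

definition weight :: "nat \<Rightarrow> ((nat \<Rightarrow> 'n::finite \<Rightarrow> real) \<Rightarrow> real) \<Rightarrow> bool" where
  "weight t W \<longleftrightarrow> W \<in> borel_measurable seq_space \<and> nonanticipating t W \<and>
     (\<forall>x. 0 \<le> W x) \<and> (\<exists>C. \<forall>x. W x \<le> C)"

lemma ret_bounds:
  assumes b: "b \<in> port_simplex" and x: "\<And>i. l \<le> x i \<and> x i \<le> u"
  shows "l \<le> ret b x \<and> ret b x \<le> u"
proof -
  have b0: "\<And>i. 0 \<le> b i" and b1: "sum b UNIV = 1"
    using b by (auto simp: port_simplex_def)
  have "(\<Sum>i\<in>UNIV. b i * l) \<le> ret b x" "ret b x \<le> (\<Sum>i\<in>UNIV. b i * u)"
    unfolding ret_def using b0 x by (auto intro!: sum_mono mult_left_mono)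
  then show ?thesis
    by (simp add: sum_distrib_right[symmetric] b1)
qed

lemma clip_bounds: "exp (-1) \<le> clip v \<and> clip v \<le> exp 1"
  by (simp add: clip_def)

lemma causal_ret_bounds:
  assumes "causal_policy \<beta>"
  shows "exp (-1) \<le> ret (\<beta> t x) (\<lambda>i. clip (x t i)) \<and> ret (\<beta> t x) (\<lambda>i. clip (x t i)) \<le> exp 1"
  using assms by (intro ret_bounds clip_bounds) (auto simp: causal_policy_def)

lemma causal_ret_pos: "causal_policy \<beta> \<Longrightarrow> 0 < ret (\<beta> t x) (\<lambda>i. clip (x t i))"
  using causal_ret_bounds[of \<beta> t x] exp_gt_zero[of "-1::real"] by linarith

lemma exp_log_ret: "causal_policy \<beta> \<Longrightarrow> exp (log_ret \<beta> t x) = ret (\<beta> t x) (\<lambda>i. clip (x t i))"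
  by (simp add: log_ret_def causal_ret_pos)

lemma log_ret_bounds:
  assumes "causal_policy \<beta>"
  shows "\<bar>log_ret \<beta> t x\<bar> \<le> 1"
proof -
  have "- 1 \<le> log_ret \<beta> t x" "log_ret \<beta> t x \<le> 1"
    using causal_ret_bounds[OF assms, of t x] exp_log_ret[OF assms, of t x]
    by (metis exp_le_cancel_iff)+
  then show ?thesis by simp
qed

lemma log_wealth_bounds:
  assumes "causal_policy \<beta>"
  shows "\<bar>log_wealth \<beta> n x\<bar> \<le> real n"
proof -
  have "\<bar>log_wealth \<beta> n x\<bar> \<le> (\<Sum>t<n. \<bar>log_ret \<beta> t x\<bar>)"
    unfolding log_wealth_def by (rule sum_abs)
  also have "\<dots> \<le> (\<Sum>t<n. 1)"
    by (intro sum_mono log_ret_bounds assms)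
  finally show ?thesis by simp
qed

lemma log_wealth_0 [simp]: "log_wealth \<beta> 0 x = 0"
  by (simp add: log_wealth_def)

lemma log_wealth_Suc: "log_wealth \<beta> (Suc n) x = log_wealth \<beta> n x + log_ret \<beta> n x"
  by (simp add: log_wealth_def)

lemma log_ret_measurable:
  assumes "causal_policy \<beta>"
  shows "log_ret \<beta> t \<in> borel_measurable seq_space"
proof -
  have [measurable]: "\<And>i. (\<lambda>x. \<beta> t x i) \<in> borel_measurable seq_space"
    using assms by (simp add: causal_policy_def)
  show ?thesis
    unfolding log_ret_def[abs_def] ret_def clip_def by measurable
qed

lemma log_wealth_measurable:
  assumes "causal_policy \<beta>"
  shows "log_wealth \<beta> n \<in> borel_measurable seq_space"
  unfolding log_wealth_def[abs_def]
  by (intro borel_measurable_sum log_ret_measurable assms)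

lemma log_ret_nonanticipating:
  assumes "causal_policy \<beta>"
  shows "nonanticipating (Suc t) (log_ret \<beta> t)"
  unfolding nonanticipating_def
proof (intro allI impI)
  fix x y :: "nat \<Rightarrow> 'a \<Rightarrow> real" assume xy: "\<forall>s<Suc t. x s = y s"
  have "\<beta> t x = \<beta> t y"
    by (rule nonanticipatingD[of t "\<beta> t"]) (use assms xy in \<open>auto simp: causal_policy_def\<close>)
  then show "log_ret \<beta> t x = log_ret \<beta> t y"
    using xy by (simp add: log_ret_def)
qed

lemma nonanticipating_sum:
  fixes D :: "nat \<Rightarrow> (nat \<Rightarrow> 'b) \<Rightarrow> 'c::comm_monoid_add"
  assumes "\<And>t. nonanticipating (Suc t) (D t)"
  shows "nonanticipating n (\<lambda>x. \<Sum>t<n. D t x)"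
  unfolding nonanticipating_def
proof (intro allI impI sum.cong refl)
  fix x y :: "nat \<Rightarrow> 'b" and t
  assume "\<forall>s<n. x s = y s" "t \<in> {..<n}"
  then show "D t x = D t y"
    by (intro nonanticipatingD[OF assms]) auto
qed

lemma log_wealth_nonanticipating:
  assumes "causal_policy \<beta>"
  shows "nonanticipating n (log_wealth \<beta> n)"
  unfolding log_wealth_def[abs_def]
  by (intro nonanticipating_sum log_ret_nonanticipating assms)

section \<open>Restarted, rolling and mixed policies\<close>

definition restart :: "(nat \<Rightarrow> (nat \<Rightarrow> 'b) \<Rightarrow> 'c) \<Rightarrow> nat \<Rightarrow> (nat \<Rightarrow> (nat \<Rightarrow> 'b) \<Rightarrow> 'c)
    \<Rightarrow> nat \<Rightarrow> (nat \<Rightarrow> 'b) \<Rightarrow> 'c" where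
  "restart \<gamma> k \<beta> t x = (if t < k then \<gamma> t x else \<beta> (t - k) ((shift_seq ^^ k) x))"

lemma nonanticipating_shift:
  assumes "nonanticipating s f" "s + k \<le> t"
  shows "nonanticipating t (\<lambda>x. f ((shift_seq ^^ k) x))"
  unfolding nonanticipating_def funpow_shift_seq
proof (intro allI impI)
  fix x y :: "nat \<Rightarrow> 'a" assume xy: "\<forall>s<t. x s = y s"
  show "f (\<lambda>s. x (s + k)) = f (\<lambda>s. y (s + k))"
    by (rule nonanticipatingD[OF assms(1)]) (use xy assms(2) in auto)
qed

text \<open>From period \<open>k\<close> on, \<beta> acts as if the market had opened at time
  \<open>k\<close>. It ignores the first \<open>k\<close> prices, so it uses less information than
  is available.\<close>

lemma causal_policy_restart:
  assumes \<gamma>: "causal_policy \<gamma>" and \<beta>: "causal_policy \<beta>"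
  shows "causal_policy (restart \<gamma> k \<beta>)"
  unfolding causal_policy_def
proof (intro allI conjI)
  fix t x i
  show "restart \<gamma> k \<beta> t x \<in> port_simplex"
    using \<gamma> \<beta> by (auto simp: restart_def causal_policy_def)
  have [measurable]: "\<And>t. (\<lambda>x. \<gamma> t x i) \<in> borel_measurable seq_space"
      "\<And>t. (\<lambda>x. \<beta> t x i) \<in> borel_measurable seq_space"
    using \<gamma> \<beta> by (auto simp: causal_policy_def)
  show "(\<lambda>x. restart \<gamma> k \<beta> t x i) \<in> borel_measurable seq_space"
    by (cases "t < k") (simp_all add: restart_def measurable_compose[OF measurable_funpow_shift])
  show "nonanticipating t (restart \<gamma> k \<beta> t)"
  proof (cases "t < k")
    case True
    then show ?thesis
      using \<gamma> by (simp add: causal_policy_def restart_def[abs_def])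
  next
    case False
    then show ?thesis
      using \<beta> nonanticipating_shift[of "t - k" "\<beta> (t - k)" k t]
      by (simp add: causal_policy_def restart_def[abs_def])
  qed
qed

lemma log_wealth_restart:
  "log_wealth (restart \<gamma> k \<beta>) (k + n) x = log_wealth \<gamma> k x + log_wealth \<beta> n ((shift_seq ^^ k) x)"
proof -
  have "log_ret (restart \<gamma> k \<beta>) t x = log_ret \<gamma> t x" if "t < k" for t
    using that by (simp add: log_ret_def restart_def)
  moreover have "log_ret (restart \<gamma> k \<beta>) (k + t) x = log_ret \<beta> t ((shift_seq ^^ k) x)" for t
    by (simp add: log_ret_def restart_def funpow_shift_seq add.commute)
  ultimately show ?thesis
    unfolding log_wealth_def sum_lessThan_add by simp
qed

text \<open>From period \<open>k\<close> on the portfolio is one fixed function of the last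
  \<open>k\<close> prices. The later log returns are therefore one function evaluated along the
  shifts of the path, and their sum is a Birkhoff sum.\<close>

definition rolling :: "(nat \<Rightarrow> (nat \<Rightarrow> 'b) \<Rightarrow> 'c) \<Rightarrow> nat \<Rightarrow> nat \<Rightarrow> (nat \<Rightarrow> 'b) \<Rightarrow> 'c" where
  "rolling \<alpha> k t x = (if t < k then \<alpha> t x else \<alpha> k ((shift_seq ^^ (t - k)) x))"

lemma causal_policy_rolling:
  assumes \<alpha>: "causal_policy \<alpha>"
  shows "causal_policy (rolling \<alpha> k)"
  unfolding causal_policy_def
proof (intro allI conjI)
  fix t x i
  show "rolling \<alpha> k t x \<in> port_simplex"
    using \<alpha> by (auto simp: rolling_def causal_policy_def)
  have [measurable]: "\<And>t. (\<lambda>x. \<alpha> t x i) \<in> borel_measurable seq_space"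
    using \<alpha> by (auto simp: causal_policy_def)
  show "(\<lambda>x. rolling \<alpha> k t x i) \<in> borel_measurable seq_space"
    by (cases "t < k") (simp_all add: rolling_def measurable_compose[OF measurable_funpow_shift])
  show "nonanticipating t (rolling \<alpha> k t)"
  proof (cases "t < k")
    case True
    then show ?thesis
      using \<alpha> by (simp add: causal_policy_def rolling_def[abs_def])
  next
    case False
    then show ?thesis
      using \<alpha> nonanticipating_shift[of k "\<alpha> k" "t - k" t]
      by (simp add: causal_policy_def rolling_def[abs_def])
  qed
qed

lemma log_wealth_rolling:
  "log_wealth (rolling \<alpha> k) (k + n) x = log_wealth \<alpha> k x + (\<Sum>i<n. log_ret \<alpha> k ((shift_seq ^^ i) x))"
proof -
  have "log_ret (rolling \<alpha> k) t x = log_ret \<alpha> t x" if "t < k" for t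
    using that by (simp add: log_ret_def rolling_def)
  moreover have "log_ret (rolling \<alpha> k) (k + t) x = log_ret \<alpha> k ((shift_seq ^^ t) x)" for t
    by (simp add: log_ret_def rolling_def funpow_shift_seq)
  ultimately show ?thesis
    unfolding log_wealth_def sum_lessThan_add by simp
qed

definition mix where
  "mix \<epsilon> \<alpha> \<beta> t x = (\<lambda>i. (1 - \<epsilon>) * \<alpha> t x i + \<epsilon> * \<beta> t x i)" for \<epsilon> :: real

lemma causal_policy_mix:
  assumes \<alpha>: "causal_policy \<alpha>" and \<beta>: "causal_policy \<beta>" and \<epsilon>: "0 \<le> \<epsilon>" "\<epsilon> \<le> 1"
  shows "causal_policy (mix \<epsilon> \<alpha> \<beta>)"
  unfolding causal_policy_def
proof (intro allI conjI)
  fix t x i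
  show "mix \<epsilon> \<alpha> \<beta> t x \<in> port_simplex"
    using \<alpha> \<beta> \<epsilon> by (auto simp: mix_def causal_policy_def port_simplex_def sum.distrib
        sum_distrib_left[symmetric])
  have [measurable]: "(\<lambda>x. \<alpha> t x i) \<in> borel_measurable seq_space"
      "(\<lambda>x. \<beta> t x i) \<in> borel_measurable seq_space"
    using \<alpha> \<beta> by (auto simp: causal_policy_def)
  show "(\<lambda>x. mix \<epsilon> \<alpha> \<beta> t x i) \<in> borel_measurable seq_space"
    unfolding mix_def by measurable
  have "nonanticipating t (\<alpha> t)" "nonanticipating t (\<beta> t)"
    using \<alpha> \<beta> by (auto simp: causal_policy_def)
  then show "nonanticipating t (mix \<epsilon> \<alpha> \<beta> t)"
    unfolding mix_def[abs_def] by (rule nonanticipating_compose2)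
qed

text \<open>Returns are linear in the portfolio, so mixing multiplies the return of \<alpha> by a
  factor affine in \<epsilon>. The strict bound on \<epsilon> keeps this factor positive.\<close>

lemma log_ret_mix:
  assumes \<alpha>: "causal_policy \<alpha>" and \<beta>: "causal_policy \<beta>" and \<epsilon>: "0 \<le> \<epsilon>" "\<epsilon> < 1"
  shows "log_ret (mix \<epsilon> \<alpha> \<beta>) t x = log_ret \<alpha> t x + ln (1 + \<epsilon> * (exp (log_ret \<beta> t x - log_ret \<alpha> t x) - 1))"
proof -
  let ?a = "exp (log_ret \<alpha> t x)" and ?b = "exp (log_ret \<beta> t x)"
  have "ret (mix \<epsilon> \<alpha> \<beta> t x) (\<lambda>i. clip (x t i)) = (1 - \<epsilon>) * ?a + \<epsilon> * ?b"
    unfolding exp_log_ret[OF \<alpha>] exp_log_ret[OF \<beta>]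
    by (simp add: mix_def ret_def sum.distrib sum_distrib_left algebra_simps sum_subtractf)
  also have "\<dots> = ?a * (1 + \<epsilon> * (?b / ?a - 1))"
    by (simp add: field_simps)
  finally have eq: "ret (mix \<epsilon> \<alpha> \<beta> t x) (\<lambda>i. clip (x t i)) = ?a * (1 + \<epsilon> * (?b / ?a - 1))" .
  have "1 + \<epsilon> * (?b / ?a - 1) = (1 - \<epsilon>) + \<epsilon> * (?b / ?a)"
    by (simp add: algebra_simps)
  moreover have "0 < (1 - \<epsilon>) + \<epsilon> * (?b / ?a)"
    using \<epsilon> by (intro add_pos_nonneg) auto
  ultimately have "0 < 1 + \<epsilon> * (?b / ?a - 1)" by simp
  then show ?thesis
    unfolding log_ret_def[of "mix \<epsilon> \<alpha> \<beta>"] eq by (simp add: ln_mult exp_diff)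
qed

text \<open>For negative y this combines exp y <= 1 / (1 - y) with (1 - y) * (1 + y + y^2) = 1 - y^3
  >= 1.\<close>

lemma exp_le_quadratic:
  fixes y :: real
  assumes "\<bar>y\<bar> \<le> 1"
  shows "exp y \<le> 1 + y + y\<^sup>2"
proof (cases "0 \<le> y")
  case True
  then show ?thesis using assms exp_bound[of y] by simp
next
  case False
  have "(1 - y) * (1 + y + y\<^sup>2) = 1 + (-y) ^ 3"
    by (simp add: power2_eq_square power3_eq_cube algebra_simps)
  then have "1 \<le> (1 - y) * (1 + y + y\<^sup>2)"
    using False zero_le_power[of "-y" 3] by linarith
  then have "1 / (1 - y) \<le> 1 + y + y\<^sup>2"
    using False by (simp add: field_simps)
  moreover have "exp y \<le> 1 / (1 - y)"
    using exp_ge_add_one_self[of "-y"] False by (simp add: exp_minus field_simps)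
  ultimately show ?thesis by linarith
qed

text \<open>Unfolding the recursion gives the sum, over all sets of restart times, of \<open>p\<close> to the number
  of restarts times the wealth of the restarted policy; the summand \<open>i\<close> has its first restart
  at time \<open>n - i\<close>.\<close>

fun restart_mixture :: "(nat \<Rightarrow> (nat \<Rightarrow> 'n::finite \<Rightarrow> real) \<Rightarrow> 'n \<Rightarrow> real) \<Rightarrow> real
    \<Rightarrow> nat \<Rightarrow> (nat \<Rightarrow> 'n \<Rightarrow> real) \<Rightarrow> real" where
  "restart_mixture \<beta> p n x = exp (log_wealth \<beta> n x) +
     (\<Sum>i<n. p * (exp (log_wealth \<beta> (n - i) x) * restart_mixture \<beta> p i ((shift_seq ^^ (n - i)) x)))"

declare restart_mixture.simps [simp del]

text \<open>This solves the recursion of \<open>restart_mixture\<close> with every wealth replaced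
  by 1: each of \<open>n\<close> dates carries a restart of weight \<open>p\<close> or none, for a
  total weight of (1 + p)^n.\<close>

lemma sum_powers_Suc: "(1::real) + (\<Sum>i<n. p * (1 + p) ^ i) = (1 + p) ^ n"
  by (induction n) (simp_all add: algebra_simps)

context
  fixes \<beta> :: "nat \<Rightarrow> (nat \<Rightarrow> 'n::finite \<Rightarrow> real) \<Rightarrow> 'n \<Rightarrow> real" and p :: real
  assumes \<beta>: "causal_policy \<beta>" and p: "0 \<le> p"
begin

lemma restart_mixture_measurable: "restart_mixture \<beta> p n \<in> borel_measurable seq_space"
proof (induction n rule: less_induct)
  case (less n)
  have [measurable]: "log_wealth \<beta> i \<in> borel_measurable seq_space" for i
    by (rule log_wealth_measurable[OF \<beta>])
  have "(\<lambda>x. restart_mixture \<beta> p i ((shift_seq ^^ (n - i)) x)) \<in> borel_measurable seq_space" if "i < n" for i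
    by (rule measurable_compose[OF measurable_funpow_shift less[OF that]])
  then show ?case
    by (subst restart_mixture.simps[abs_def])
      (intro borel_measurable_add borel_measurable_sum borel_measurable_times borel_measurable_const
        borel_measurable_exp[THEN measurable_compose[rotated]] log_wealth_measurable \<beta>, auto)
qed

lemma restart_mixture_ge: "exp (log_wealth \<beta> n x) \<le> restart_mixture \<beta> p n x"
proof (induction n arbitrary: x rule: less_induct)
  case (less n)
  have "0 \<le> restart_mixture \<beta> p i y" if "i < n" for i y
    using less[OF that, of y] exp_gt_zero[of "log_wealth \<beta> i y"] by linarith
  then show ?case
    by (subst restart_mixture.simps) (auto intro!: sum_nonneg mult_nonneg_nonneg p)
qed

lemma restart_mixture_pos: "0 < restart_mixture \<beta> p n x"
  using restart_mixture_ge[of n x] exp_gt_zero[of "log_wealth \<beta> n x"] by linarith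

lemma restart_mixture_le: "restart_mixture \<beta> p n x \<le> exp (real n) * (1 + p) ^ n"
proof (induction n arbitrary: x rule: less_induct)
  case (less n)
  have wealth_le: "exp (log_wealth \<beta> i y) \<le> exp (real i)" for i y
    using log_wealth_bounds[OF \<beta>, of i y] by simp
  have "restart_mixture \<beta> p n x \<le> exp (real n) + (\<Sum>i<n. p * (exp (real (n - i)) * (exp (real i) * (1 + p) ^ i)))"
    using p restart_mixture_pos
    by (subst restart_mixture.simps)
      (intro add_mono wealth_le sum_mono mult_left_mono mult_mono less, auto intro: less_imp_le)
  also have "\<dots> = exp (real n) + (\<Sum>i<n. exp (real n) * (p * (1 + p) ^ i))"
    by (intro arg_cong2[where f="(+)"] sum.cong) (auto simp: exp_add[symmetric] of_nat_diff mult_ac mult_exp_exp)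
  also have "\<dots> = exp (real n) * (1 + p) ^ n"
    by (subst sum_powers_Suc[symmetric]) (simp add: sum_distrib_left distrib_left)
  finally show ?case .
qed

text \<open>Keep only the summand whose first restart is at time \<open>j\<close>. For positive
  \<open>p\<close>, taking logarithms gives superadditivity with the constant error - ln p on every
  path.\<close>

lemma restart_mixture_super:
  assumes "1 \<le> j" "j \<le> n"
  shows "p * (exp (log_wealth \<beta> j x) * restart_mixture \<beta> p (n - j) ((shift_seq ^^ j) x)) \<le> restart_mixture \<beta> p n x"
proof -
  let ?g = "\<lambda>i. p * (exp (log_wealth \<beta> (n - i) x) * restart_mixture \<beta> p i ((shift_seq ^^ (n - i)) x))"
  have "?g (n - j) \<le> (\<Sum>i<n. ?g i)"
    using assms p by (intro member_le_sum) (auto intro!: mult_nonneg_nonneg less_imp_le[OF restart_mixture_pos])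
  also have "\<dots> \<le> restart_mixture \<beta> p n x"
    by (subst restart_mixture.simps) simp
  finally show ?thesis
    using assms by simp
qed

end

section \<open>Growth rate of the log-optimal policy\<close>

locale market = ergodic_system P shift_seq
  for P :: "(nat \<Rightarrow> 'n::finite \<Rightarrow> real) measure" +
  fixes \<alpha> :: "nat \<Rightarrow> (nat \<Rightarrow> 'n \<Rightarrow> real) \<Rightarrow> 'n \<Rightarrow> real"
  assumes sets_P [measurable_cong]: "sets P = sets seq_space"
    and causal_\<alpha>: "causal_policy \<alpha>"
    and optimal: "\<And>\<beta> t W. causal_policy \<beta> \<Longrightarrow> weight t W \<Longrightarrow>
      (\<integral>x. W x * (log_ret \<beta> t x - log_ret \<alpha> t x) \<partial>P) \<le> 0"
begin

section \<open>Integrability and an exponential supermartingale bound\<close>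

lemma space_P [simp]: "space P = UNIV"
  using sets_eq_imp_space_eq[OF sets_P] by simp

lemma measurable_P: "f \<in> borel_measurable P \<longleftrightarrow> f \<in> borel_measurable seq_space"
  by (simp add: measurable_cong_sets[OF sets_P])

lemma integrable_bounded:
  fixes f :: "_ \<Rightarrow> real"
  assumes "f \<in> borel_measurable seq_space" "\<And>x. \<bar>f x\<bar> \<le> C"
  shows "integrable P f"
  by (rule integrable_const_bound[where B=C]) (use assms in \<open>auto simp: measurable_P\<close>)

text \<open>The exponential of \<theta> times the partial sum is itself a weight. In the quadratic
  bound for the next factor, the linear term therefore has nonpositive expectation, and only a
  growth of exp (\<theta>^2 * K^2 * n) remains. Against the threshold exp (\<theta> * \<epsilon> *
  n), Markov's inequality leaves a geometric series.\<close>

lemma supermartingale_growth: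
  fixes D :: "nat \<Rightarrow> (nat \<Rightarrow> 'n \<Rightarrow> real) \<Rightarrow> real"
  assumes D_meas: "\<And>t. D t \<in> borel_measurable seq_space"
    and D_nonant: "\<And>t. nonanticipating (Suc t) (D t)"
    and D_bound: "\<And>t x. \<bar>D t x\<bar> \<le> K" and K: "0 < K"
    and D_super: "\<And>t W. weight t W \<Longrightarrow> (\<integral>x. W x * D t x \<partial>P) \<le> 0"
  shows "AE x in P. \<forall>\<epsilon>>0. \<forall>\<^sub>F n in sequentially. (\<Sum>t<n. D t x) \<le> \<epsilon> * real n"
proof -
  have [measurable]: "D t \<in> borel_measurable P" for t
    using D_meas by (simp add: measurable_P)
  have sum_bound: "\<bar>\<Sum>t<n. D t x\<bar> \<le> K * real n" for n x
  proof -
    have "\<bar>\<Sum>t<n. D t x\<bar> \<le> (\<Sum>t<n. \<bar>D t x\<bar>)"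
      by (rule sum_abs)
    also have "\<dots> \<le> (\<Sum>t<n. K)"
      by (intro sum_mono D_bound)
    finally show ?thesis by (simp add: mult.commute)
  qed
  have main: "AE x in P. \<forall>\<^sub>F n in sequentially. (\<Sum>t<n. D t x) \<le> \<epsilon> * real n" if \<epsilon>: "0 < \<epsilon>" for \<epsilon>
  proof -
    \<comment> \<open>The first bound makes \<open>exp_le_quadratic\<close> applicable. The second
      keeps the quadratic growth rate at most half of the Markov exponent \<theta> *
      \<epsilon>.\<close>
    define \<theta> where "\<theta> = min (1 / K) (\<epsilon> / (2 * K\<^sup>2))"
    have \<theta>: "0 < \<theta>" using K \<epsilon> by (simp add: \<theta>_def)
    have "\<theta> \<le> 1 / K" "\<theta> \<le> \<epsilon> / (2 * K\<^sup>2)"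
      by (auto simp: \<theta>_def)
    then have \<theta>K: "\<theta> * K \<le> 1" and \<theta>\<epsilon>: "\<theta> * K\<^sup>2 \<le> \<epsilon> / 2"
      using K by (auto simp: field_simps)
    define R where "R n x = exp (\<theta> * (\<Sum>t<n. D t x))" for n x
    have [measurable]: "R n \<in> borel_measurable P" for n
      unfolding R_def[abs_def] by measurable
    have R_bound: "R n x \<le> exp (\<theta> * (K * real n))" for n x
      unfolding R_def using \<theta> sum_bound[of x n] by (auto intro!: mult_left_mono)
    have R_int: "integrable P (R n)" for n
      by (rule integrable_bounded[where C="exp (\<theta> * (K * real n))"])
        (use R_bound in \<open>auto simp: measurable_P[symmetric] R_def\<close>)
    have R_weight: "weight n (R n)" for n
      unfolding weight_def
    proof (intro conjI)
      show "R n \<in> borel_measurable seq_space" by (simp add: measurable_P[symmetric])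
      show "nonanticipating n (R n)"
        unfolding R_def[abs_def] by (rule nonanticipating_compose2) (rule nonanticipating_sum[OF D_nonant])+
      show "\<forall>x. 0 \<le> R n x" by (simp add: R_def)
      show "\<exists>C. \<forall>x. R n x \<le> C" using R_bound by blast
    qed
    have R_le: "(\<integral>x. R n x \<partial>P) \<le> exp (\<theta>\<^sup>2 * K\<^sup>2 * real n)" for n
    proof (induction n)
      case 0
      then show ?case by (simp add: R_def prob_space)
    next
      case (Suc n)
      have RD_int: "integrable P (\<lambda>x. R n x * D n x)"
      proof (rule Bochner_Integration.integrable_bound[OF integrable_mult_right[OF R_int[of n], of K]])
        show "AE x in P. norm (R n x * D n x) \<le> norm (K * R n x)"
          using D_bound K by (auto simp: R_def abs_mult mult.commute intro!: mult_right_mono)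
      qed simp
      have step: "R (Suc n) x \<le> (1 + \<theta>\<^sup>2 * K\<^sup>2) * R n x + \<theta> * (R n x * D n x)" for x
      proof -
        have le: "\<bar>\<theta> * D n x\<bar> \<le> \<theta> * K"
          using D_bound[of n x] \<theta> by (simp add: abs_mult mult_left_mono)
        then have "exp (\<theta> * D n x) \<le> 1 + \<theta> * D n x + (\<theta> * D n x)\<^sup>2"
          using \<theta>K by (intro exp_le_quadratic) linarith
        also have "(\<theta> * D n x)\<^sup>2 \<le> (\<theta> * K)\<^sup>2"
          using le by (metis abs_le_square_iff abs_of_nonneg abs_ge_zero order_trans)
        finally have "exp (\<theta> * D n x) \<le> 1 + \<theta> * D n x + \<theta>\<^sup>2 * K\<^sup>2"
          by (simp add: power_mult_distrib)
        then have "R n x * exp (\<theta> * D n x) \<le> R n x * (1 + \<theta> * D n x + \<theta>\<^sup>2 * K\<^sup>2)"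
          by (intro mult_left_mono) (auto simp: R_def)
        moreover have "R (Suc n) x = R n x * exp (\<theta> * D n x)"
          by (simp add: R_def exp_add[symmetric] algebra_simps)
        ultimately show ?thesis by (simp add: algebra_simps)
      qed
      have "(\<integral>x. R (Suc n) x \<partial>P) \<le> (\<integral>x. (1 + \<theta>\<^sup>2 * K\<^sup>2) * R n x + \<theta> * (R n x * D n x) \<partial>P)"
        using R_int RD_int step by (intro integral_mono) auto
      also have "\<dots> = (1 + \<theta>\<^sup>2 * K\<^sup>2) * (\<integral>x. R n x \<partial>P) + \<theta> * (\<integral>x. R n x * D n x \<partial>P)"
        using R_int RD_int by simp
      also have "\<dots> \<le> (1 + \<theta>\<^sup>2 * K\<^sup>2) * (\<integral>x. R n x \<partial>P)"
        using D_super[OF R_weight[of n]] \<theta> by (simp add: mult_nonneg_nonpos)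
      also have "\<dots> \<le> exp (\<theta>\<^sup>2 * K\<^sup>2) * exp (\<theta>\<^sup>2 * K\<^sup>2 * real n)"
        using Suc.IH by (intro mult_mono exp_ge_add_one_self) (auto simp: R_def)
      also have "\<dots> = exp (\<theta>\<^sup>2 * K\<^sup>2 * real (Suc n))"
        by (simp add: exp_add[symmetric] algebra_simps)
      finally show ?case .
    qed
    define B where "B n = {x \<in> space P. exp (\<theta> * \<epsilon> * real n) \<le> R n x}" for n
    have [measurable]: "B n \<in> sets P" for n
      unfolding B_def by measurable
    have B_le: "prob (B n) \<le> exp (- (\<theta> * \<epsilon> / 2)) ^ n" for n
    proof -
      have "prob (B n) \<le> (\<integral>x. R n x \<partial>P) / exp (\<theta> * \<epsilon> * real n)"
        unfolding B_def
        by (rule integral_Markov_inequality_measure[OF R_int sets.top]) (auto simp: R_def)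
      also have "\<dots> \<le> exp (\<theta>\<^sup>2 * K\<^sup>2 * real n) / exp (\<theta> * \<epsilon> * real n)"
        by (intro divide_right_mono R_le) simp
      also have "\<dots> = exp (\<theta> * real n * (\<theta> * K\<^sup>2 - \<epsilon>))"
        by (simp add: exp_diff[symmetric] power2_eq_square algebra_simps)
      also have "\<dots> \<le> exp (\<theta> * real n * (- (\<epsilon> / 2)))"
        using \<theta> \<theta>\<epsilon> by (subst exp_le_cancel_iff, intro mult_left_mono) auto
      also have "\<dots> = exp (- (\<theta> * \<epsilon> / 2)) ^ n"
        by (simp add: exp_of_nat_mult[symmetric] algebra_simps)
      finally show ?thesis .
    qed
    have "AE x in P. \<forall>\<^sub>F n in sequentially. x \<in> space P - B n"
    proof (rule borel_cantelli_AE1)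
      have "summable (\<lambda>n. exp (- (\<theta> * \<epsilon> / 2)) ^ n)"
        using \<theta> \<epsilon> by (intro summable_geometric) simp
      then show "summable (\<lambda>n. prob (B n))"
        by (rule summable_comparison_test') (use B_le in simp)
    qed (simp_all add: emeasure_eq_measure)
    then show ?thesis
    proof eventually_elim
      case (elim x)
      then show ?case
      proof eventually_elim
        case (elim n)
        then have "\<theta> * (\<Sum>t<n. D t x) < \<theta> * (\<epsilon> * real n)"
          by (simp add: B_def R_def algebra_simps)
        then show ?case using \<theta> by simp
      qed
    qed
  qed
  have "AE x in P. \<forall>m. \<forall>\<^sub>F n in sequentially. (\<Sum>t<n. D t x) \<le> 1 / real (Suc m) * real n"
    unfolding AE_all_countable by (intro allI main) simp
  then show ?thesis
  proof eventually_elim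
    case (elim x)
    show ?case
    proof (intro allI impI)
      fix \<epsilon> :: real assume "0 < \<epsilon>"
      then obtain m where m: "1 / real (Suc m) < \<epsilon>"
        using reals_Archimedean[of "\<epsilon>"] by (auto simp: inverse_eq_divide)
      have "1 / real (Suc m) * real n \<le> \<epsilon> * real n" for n
        using m by (intro mult_right_mono) auto
      then show "\<forall>\<^sub>F n in sequentially. (\<Sum>t<n. D t x) \<le> \<epsilon> * real n"
        using elim[rule_format, of m] by (auto elim!: eventually_mono intro: order_trans)
    qed
  qed
qed

lemma log_wealth_dominated:
  assumes \<beta>: "causal_policy \<beta>"
  shows "AE x in P. \<forall>\<epsilon>>0. \<forall>\<^sub>F n in sequentially. log_wealth \<beta> n x \<le> log_wealth \<alpha> n x + \<epsilon> * real n"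
proof -
  have "AE x in P. \<forall>\<epsilon>>0. \<forall>\<^sub>F n in sequentially. (\<Sum>t<n. log_ret \<beta> t x - log_ret \<alpha> t x) \<le> \<epsilon> * real n"
  proof (rule supermartingale_growth[where K=2])
    show "(\<lambda>x. log_ret \<beta> t x - log_ret \<alpha> t x) \<in> borel_measurable seq_space" for t
      by (intro borel_measurable_diff log_ret_measurable \<beta> causal_\<alpha>)
    show "nonanticipating (Suc t) (\<lambda>x. log_ret \<beta> t x - log_ret \<alpha> t x)" for t
      by (rule nonanticipating_compose2[OF log_ret_nonanticipating[OF \<beta>] log_ret_nonanticipating[OF causal_\<alpha>]])
    show "\<bar>log_ret \<beta> t x - log_ret \<alpha> t x\<bar> \<le> 2" for t x
      using log_ret_bounds[OF \<beta>, of t x] log_ret_bounds[OF causal_\<alpha>, of t x] by linarith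
  qed (auto intro: optimal \<beta>)
  then show ?thesis
    by (simp add: sum_subtractf log_wealth_def algebra_simps)
qed

text \<open>First-order optimality condition, from perturbing \<open>\<alpha>\<close> towards \<open>\<beta>\<close> by a small amount \<open>\<epsilon>\<close>.\<close>

lemma optimal_ratio:
  assumes \<beta>: "causal_policy \<beta>" and W: "weight t W"
  shows "(\<integral>x. W x * exp (log_ret \<beta> t x - log_ret \<alpha> t x) \<partial>P) \<le> (\<integral>x. W x \<partial>P)"
proof -
  define U where "U x = exp (log_ret \<beta> t x - log_ret \<alpha> t x) - 1" for x
  obtain C where C: "\<And>x. W x \<le> C" and W0: "\<And>x. 0 \<le> W x"
    and W_meas [measurable]: "W \<in> borel_measurable seq_space"
    using W by (auto simp: weight_def)
  have [measurable]: "U \<in> borel_measurable seq_space"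
    using log_ret_measurable[OF \<beta>, of t] log_ret_measurable[OF causal_\<alpha>, of t]
    unfolding U_def[abs_def] by measurable
  have U_bound: "\<bar>U x\<bar> \<le> 9" for x
  proof -
    have "log_ret \<beta> t x - log_ret \<alpha> t x \<le> 2"
      using log_ret_bounds[OF \<beta>, of t x] log_ret_bounds[OF causal_\<alpha>, of t x] by linarith
    then have "exp (log_ret \<beta> t x - log_ret \<alpha> t x) \<le> exp 1 * exp 1"
      by (simp add: exp_add[symmetric])
    also have "\<dots> \<le> 3 * 3"
      by (intro mult_mono exp_le) auto
    finally show ?thesis
      unfolding U_def abs_le_iff using exp_gt_zero[of "log_ret \<beta> t x - log_ret \<alpha> t x"] by linarith
  qed
  have W_int: "integrable P W"
    by (rule integrable_bounded[where C=C]) (use C W0 in auto)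
  have WU_int: "integrable P (\<lambda>x. W x * U x)"
    by (rule integrable_bounded[where C="C * 9"])
      (use U_bound C W0 in \<open>auto simp: abs_mult intro!: mult_mono order_trans[OF W0 C]\<close>)
  \<comment> \<open>The bound on \<epsilon> puts \<epsilon> * U into [-1/2, 1/2], where ln (1 + y)
    differs from y by at most 2 * y^2. Since |U| <= 9, the error is at most 162 * \<epsilon>^2.
    Optimality against the mixed policy gives the claim after division by \<epsilon>.\<close>
  have le: "(\<integral>x. W x * U x \<partial>P) \<le> \<epsilon> * (162 * (\<integral>x. W x \<partial>P))" if \<epsilon>: "0 < \<epsilon>" "\<epsilon> \<le> 1 / 18" for \<epsilon>
  proof -
    have small: "\<bar>\<epsilon> * U x\<bar> \<le> 1 / 2" for x
    proof -
      have "\<bar>\<epsilon> * U x\<bar> \<le> 1 / 18 * 9"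
        using \<epsilon> U_bound[of x] unfolding abs_mult by (intro mult_mono) auto
      then show ?thesis by simp
    qed
    have cm: "causal_policy (mix \<epsilon> \<alpha> \<beta>)"
      using \<epsilon> by (intro causal_policy_mix causal_\<alpha> \<beta>) auto
    have pw: "W x * (\<epsilon> * U x - 162 * \<epsilon>\<^sup>2) \<le> W x * (log_ret (mix \<epsilon> \<alpha> \<beta>) t x - log_ret \<alpha> t x)" for x
    proof (intro mult_left_mono W0)
      have "log_ret (mix \<epsilon> \<alpha> \<beta>) t x - log_ret \<alpha> t x = ln (1 + \<epsilon> * U x)"
        using log_ret_mix[OF causal_\<alpha> \<beta>, of \<epsilon> t x] \<epsilon> by (simp add: U_def)
      moreover have "\<bar>ln (1 + \<epsilon> * U x) - \<epsilon> * U x\<bar> \<le> 2 * (\<epsilon> * U x)\<^sup>2"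
        by (rule abs_ln_one_plus_x_minus_x_bound[OF small])
      moreover have "(U x)\<^sup>2 \<le> 9\<^sup>2"
        using U_bound[of x] by (intro abs_le_square_iff[THEN iffD1]) simp
      then have "2 * (\<epsilon> * U x)\<^sup>2 \<le> 162 * \<epsilon>\<^sup>2"
        unfolding power_mult_distrib by (simp add: mult.commute mult_left_mono)
      ultimately show "\<epsilon> * U x - 162 * \<epsilon>\<^sup>2 \<le> log_ret (mix \<epsilon> \<alpha> \<beta>) t x - log_ret \<alpha> t x"
        by linarith
    qed
    have [measurable]: "log_ret (mix \<epsilon> \<alpha> \<beta>) t \<in> borel_measurable seq_space" "log_ret \<alpha> t \<in> borel_measurable seq_space"
      by (intro log_ret_measurable cm causal_\<alpha>)+
    have "integrable P (\<lambda>x. W x * (log_ret (mix \<epsilon> \<alpha> \<beta>) t x - log_ret \<alpha> t x))"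
    proof (rule integrable_bounded[where C="C * 2"])
      fix x
      have "\<bar>log_ret (mix \<epsilon> \<alpha> \<beta>) t x - log_ret \<alpha> t x\<bar> \<le> 2"
        using log_ret_bounds[OF cm, of t x] log_ret_bounds[OF causal_\<alpha>, of t x] by linarith
      then show "\<bar>W x * (log_ret (mix \<epsilon> \<alpha> \<beta>) t x - log_ret \<alpha> t x)\<bar> \<le> C * 2"
        using C W0 by (auto simp: abs_mult intro!: mult_mono order_trans[OF W0 C])
    qed simp
    then have "(\<integral>x. W x * (\<epsilon> * U x - 162 * \<epsilon>\<^sup>2) \<partial>P) \<le> (\<integral>x. W x * (log_ret (mix \<epsilon> \<alpha> \<beta>) t x - log_ret \<alpha> t x) \<partial>P)"
      using pw WU_int W_int by (intro integral_mono) (auto simp: right_diff_distrib mult.left_commute)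
    also have "\<dots> \<le> 0"
      by (rule optimal[OF cm W])
    also have "(\<integral>x. W x * (\<epsilon> * U x - 162 * \<epsilon>\<^sup>2) \<partial>P)
        = (\<integral>x. \<epsilon> * (W x * U x) - (162 * \<epsilon>\<^sup>2) * W x \<partial>P)"
      by (simp add: algebra_simps)
    also have "\<dots> = \<epsilon> * (\<integral>x. W x * U x \<partial>P) - (162 * \<epsilon>\<^sup>2) * (\<integral>x. W x \<partial>P)"
      using WU_int W_int by simp
    finally have "\<epsilon> * (\<integral>x. W x * U x \<partial>P) \<le> \<epsilon> * (\<epsilon> * (162 * (\<integral>x. W x \<partial>P)))"
      by (simp add: power2_eq_square algebra_simps)
    then show ?thesis using \<epsilon> by simp
  qed
  have "(\<integral>x. W x * U x \<partial>P) \<le> 0"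
  proof (rule ccontr)
    let ?I = "\<integral>x. W x * U x \<partial>P" and ?J = "162 * (\<integral>x. W x \<partial>P)"
    assume "\<not> ?I \<le> 0"
    then have I: "0 < ?I" by simp
    have J: "0 \<le> ?J" using W0 by simp
    \<comment> \<open>With this choice \<open>le\<close> would give ?I <= ?I / 2. The added 1 keeps
      the denominator positive.\<close>
    define \<epsilon> where "\<epsilon> = min (1 / 18) (?I / (2 * (?J + 1)))"
    have \<epsilon>: "0 < \<epsilon>" "\<epsilon> \<le> 1 / 18" "\<epsilon> \<le> ?I / (2 * (?J + 1))"
    proof -
      show "0 < \<epsilon>"
        unfolding \<epsilon>_def min_less_iff_conj using I J by (intro conjI divide_pos_pos) auto
    qed (simp_all only: \<epsilon>_def min.cobounded1 min.cobounded2)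
    have "\<epsilon> * ?J \<le> \<epsilon> * (?J + 1)" using \<epsilon> by simp
    also have "\<dots> \<le> ?I / (2 * (?J + 1)) * (?J + 1)"
      using J \<epsilon>(3) by (intro mult_right_mono) auto
    also have "\<dots> = ?I / 2" using J by (simp add: field_simps)
    finally show False using le[OF \<epsilon>(1,2)] I by linarith
  qed
  moreover have "(\<integral>x. W x * U x \<partial>P) = (\<integral>x. W x * exp (log_ret \<beta> t x - log_ret \<alpha> t x) \<partial>P) - (\<integral>x. W x \<partial>P)"
  proof -
    have "integrable P (\<lambda>x. W x * U x + W x)"
      using WU_int W_int by simp
    then have "integrable P (\<lambda>x. W x * exp (log_ret \<beta> t x - log_ret \<alpha> t x))"
      by (simp add: U_def right_diff_distrib)
    then show ?thesis
      using W_int by (simp add: U_def right_diff_distrib)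
  qed
  ultimately show ?thesis by simp
qed

text \<open>The wealth ratio before period \<open>n\<close> is a weight at time \<open>n\<close>, so
  by \<open>optimal_ratio\<close> one more period does not raise its expectation. This is the
  numeraire property of the log-optimal portfolio.\<close>

lemma wealth_ratio:
  assumes \<beta>: "causal_policy \<beta>"
  shows "(\<integral>x. exp (log_wealth \<beta> n x - log_wealth \<alpha> n x) \<partial>P) \<le> 1"
proof (induction n)
  case 0
  then show ?case by (simp add: prob_space)
next
  case (Suc n)
  let ?W = "\<lambda>x. exp (log_wealth \<beta> n x - log_wealth \<alpha> n x)"
  have "weight n ?W"
    unfolding weight_def
  proof (intro conjI)
    show "?W \<in> borel_measurable seq_space"
      using log_wealth_measurable[OF \<beta>] log_wealth_measurable[OF causal_\<alpha>] by measurable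
    show "nonanticipating n ?W"
      by (rule nonanticipating_compose2[OF log_wealth_nonanticipating[OF \<beta>] log_wealth_nonanticipating[OF causal_\<alpha>]])
    have "?W x \<le> exp (2 * real n)" for x
      using log_wealth_bounds[OF \<beta>, of n x] log_wealth_bounds[OF causal_\<alpha>, of n x] by simp
    then show "\<exists>C. \<forall>x. ?W x \<le> C" by blast
  qed simp
  from optimal_ratio[OF \<beta> this] Suc.IH show ?case
    by (simp add: log_wealth_Suc exp_add[symmetric] algebra_simps)
qed

lemma prob_UNIV [simp]: "prob UNIV = 1"
  using prob_space by simp

text \<open>The prefix \<gamma> and the time \<open>k\<close> are general so that the induction can
  absorb a restart. In the recursion, the term without restart is the wealth ratio of
  \<open>restart \<gamma> k \<alpha>\<close>, at most 1 in expectation. A first restart at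
  \<open>k + (n - i)\<close> leaves an expression of the same kind, with that policy as prefix and
  \<open>i\<close> periods to go.\<close>

lemma restart_mixture_ratio:
  assumes p: "0 \<le> p" and \<gamma>: "causal_policy \<gamma>"
  shows "(\<integral>x. exp (log_wealth \<gamma> k x - log_wealth \<alpha> (k + n) x) * restart_mixture \<alpha> p n ((shift_seq ^^ k) x) \<partial>P)
    \<le> (1 + p) ^ n"
  using \<gamma>
proof (induction n arbitrary: k \<gamma> rule: less_induct)
  case (less n)
  note \<gamma> = less.prems
  define f where "f \<gamma> k i x = exp (log_wealth \<gamma> k x - log_wealth \<alpha> (k + i) x) * restart_mixture \<alpha> p i ((shift_seq ^^ k) x)"
    for \<gamma> k i x
  have f_int: "integrable P (f \<gamma> k i)" if \<gamma>: "causal_policy \<gamma>" for \<gamma> k i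
  proof (rule integrable_bounded[where C="exp (real k + real (k + i)) * (exp (real i) * (1 + p) ^ i)"])
    have [measurable]: "log_wealth \<gamma> j \<in> borel_measurable seq_space" "log_wealth \<alpha> j \<in> borel_measurable seq_space" 
        "restart_mixture \<alpha> p j \<in> borel_measurable seq_space" for j
      by (intro log_wealth_measurable restart_mixture_measurable \<gamma> causal_\<alpha> p)+
    show "f \<gamma> k i \<in> borel_measurable seq_space"
      unfolding f_def[abs_def] by measurable
    show "\<bar>f \<gamma> k i x\<bar> \<le> exp (real k + real (k + i)) * (exp (real i) * (1 + p) ^ i)" for x
    proof -
      have "log_wealth \<gamma> k x - log_wealth \<alpha> (k + i) x \<le> real k + real (k + i)"
        using log_wealth_bounds[OF \<gamma>, of k x] log_wealth_bounds[OF causal_\<alpha>, of "k + i" x] by linarith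
      then show ?thesis
        unfolding f_def abs_mult using restart_mixture_pos[OF causal_\<alpha> p, of i "(shift_seq ^^ k) x"]
          restart_mixture_le[OF causal_\<alpha> p, of i "(shift_seq ^^ k) x"]
        by (intro mult_mono) auto
    qed
  qed
  have cr: "causal_policy (restart \<gamma> k \<alpha>)"
    by (intro causal_policy_restart \<gamma> causal_\<alpha>)
  have first: "exp (log_wealth \<gamma> k x - log_wealth \<alpha> (k + n) x) * exp (log_wealth \<alpha> n ((shift_seq ^^ k) x))
      = exp (log_wealth (restart \<gamma> k \<alpha>) (k + n) x - log_wealth \<alpha> (k + n) x)" for x
    by (simp add: log_wealth_restart exp_add[symmetric] algebra_simps)
  have rest: "exp (log_wealth \<gamma> k x - log_wealth \<alpha> (k + n) x) *
        (exp (log_wealth \<alpha> (n - i) ((shift_seq ^^ k) x)) *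
         restart_mixture \<alpha> p i ((shift_seq ^^ (n - i)) ((shift_seq ^^ k) x)))
      = f (restart \<gamma> k \<alpha>) (k + (n - i)) i x" if "i < n" for i x
  proof -
    have eq: "k + (n - i) + i = k + n" using that by simp
    have "exp (log_wealth \<gamma> k x - a) * (exp (log_wealth \<alpha> j ((shift_seq ^^ k) x)) *
        restart_mixture \<alpha> p i ((shift_seq ^^ j) ((shift_seq ^^ k) x)))
      = exp (log_wealth (restart \<gamma> k \<alpha>) (k + j) x - a) * restart_mixture \<alpha> p i ((shift_seq ^^ (k + j)) x)" for j a
      by (simp add: log_wealth_restart funpow_add_swap exp_add exp_diff)
    then show ?thesis
      unfolding f_def eq .
  qed
  have expand: "f \<gamma> k n x = exp (log_wealth (restart \<gamma> k \<alpha>) (k + n) x - log_wealth \<alpha> (k + n) x)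
      + (\<Sum>i<n. p * f (restart \<gamma> k \<alpha>) (k + (n - i)) i x)" for x
  proof -
    have "f \<gamma> k n x = exp (log_wealth \<gamma> k x - log_wealth \<alpha> (k + n) x) * exp (log_wealth \<alpha> n ((shift_seq ^^ k) x))
      + (\<Sum>i<n. p * (exp (log_wealth \<gamma> k x - log_wealth \<alpha> (k + n) x) *
        (exp (log_wealth \<alpha> (n - i) ((shift_seq ^^ k) x)) *
         restart_mixture \<alpha> p i ((shift_seq ^^ (n - i)) ((shift_seq ^^ k) x)))))"
      unfolding f_def by (subst restart_mixture.simps) (simp add: distrib_left sum_distrib_left mult.left_commute)
    also have "\<dots> = exp (log_wealth (restart \<gamma> k \<alpha>) (k + n) x - log_wealth \<alpha> (k + n) x)
      + (\<Sum>i<n. p * f (restart \<gamma> k \<alpha>) (k + (n - i)) i x)"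
      unfolding first by (intro arg_cong2[where f="(+)"] sum.cong refl) (simp add: rest)
    finally show ?thesis .
  qed
  have int1: "integrable P (\<lambda>x. exp (log_wealth (restart \<gamma> k \<alpha>) (k + n) x - log_wealth \<alpha> (k + n) x))"
  proof (rule integrable_bounded[where C="exp (2 * real (k + n))"])
    show "(\<lambda>x. exp (log_wealth (restart \<gamma> k \<alpha>) (k + n) x - log_wealth \<alpha> (k + n) x)) \<in> borel_measurable seq_space"
      using log_wealth_measurable[OF cr] log_wealth_measurable[OF causal_\<alpha>] by measurable
    show "\<bar>exp (log_wealth (restart \<gamma> k \<alpha>) (k + n) x - log_wealth \<alpha> (k + n) x)\<bar> \<le> exp (2 * real (k + n))" for x
      using log_wealth_bounds[OF cr, of "k + n" x] log_wealth_bounds[OF causal_\<alpha>, of "k + n" x] by simp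
  qed
  have "(\<integral>x. f \<gamma> k n x \<partial>P) = (\<integral>x. exp (log_wealth (restart \<gamma> k \<alpha>) (k + n) x - log_wealth \<alpha> (k + n) x) \<partial>P)
      + (\<Sum>i<n. p * (\<integral>x. f (restart \<gamma> k \<alpha>) (k + (n - i)) i x \<partial>P))"
    unfolding expand using int1 f_int[OF cr]
    by (subst Bochner_Integration.integral_add) (auto simp: Bochner_Integration.integral_sum)
  also have "\<dots> \<le> 1 + (\<Sum>i<n. p * (1 + p) ^ i)"
  proof (intro add_mono wealth_ratio cr sum_mono mult_left_mono p)
    show "(\<integral>x. f (restart \<gamma> k \<alpha>) (k + (n - i)) i x \<partial>P) \<le> (1 + p) ^ i" if "i \<in> {..<n}" for i
      unfolding f_def using that by (intro less.IH cr) simp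
  qed
  also have "\<dots> = (1 + p) ^ n"
    by (rule sum_powers_Suc)
  finally show ?case
    by (simp add: f_def)
qed

section \<open>Expected logarithm of the mixture and the growth rate\<close>

lemma log_wealth_integrable: "causal_policy \<beta> \<Longrightarrow> integrable P (log_wealth \<beta> n)"
  by (rule integrable_bounded[OF log_wealth_measurable log_wealth_bounds])

lemma log_ret_integrable: "causal_policy \<beta> \<Longrightarrow> integrable P (log_ret \<beta> n)"
  by (rule integrable_bounded[OF log_ret_measurable log_ret_bounds])

text \<open>Jensen's inequality in the form ln y <= y - 1, where y is the ratio of the mixture to
  the log-optimal wealth, divided by (1 + p)^n. Its expectation is at most 1 by
  \<open>restart_mixture_ratio\<close>.\<close>

lemma log_restart_mixture:
  assumes p: "0 \<le> p"
  shows "integrable P (\<lambda>x. ln (restart_mixture \<alpha> p n x))"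
    and "(\<integral>x. ln (restart_mixture \<alpha> p n x) \<partial>P) \<le> (\<integral>x. log_wealth \<alpha> n x \<partial>P) + real n * p"
proof -
  let ?Z = "restart_mixture \<alpha> p n" and ?L = "log_wealth \<alpha> n"
  have [measurable]: "?Z \<in> borel_measurable seq_space" "?L \<in> borel_measurable seq_space"
    by (intro log_wealth_measurable restart_mixture_measurable causal_\<alpha> p)+
  note pos = restart_mixture_pos[OF causal_\<alpha> p, of n]
  have ln_p: "ln (1 + p) \<le> p" using p by (simp add: ln_add_one_self_le_self)
  have ln_ge: "- real n \<le> ln (?Z x)" for x
  proof -
    have "?L x \<le> ln (?Z x)"
      using restart_mixture_ge[OF causal_\<alpha> p, of n x] pos by (simp add: ln_ge_iff)
    then show ?thesis using log_wealth_bounds[OF causal_\<alpha>, of n x] by linarith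
  qed
  have ln_le: "ln (?Z x) \<le> real n * (1 + p)" for x
  proof -
    have "ln (?Z x) \<le> ln (exp (real n) * (1 + p) ^ n)"
      by (subst ln_le_cancel_iff) (use restart_mixture_le[OF causal_\<alpha> p, of n x] pos[of x] p in auto)
    also have "\<dots> = real n + real n * ln (1 + p)"
      using p by (simp add: ln_mult ln_realpow)
    also have "\<dots> \<le> real n * (1 + p)"
      using ln_p by (simp add: distrib_left mult_left_mono)
    finally show ?thesis .
  qed
  show int: "integrable P (\<lambda>x. ln (?Z x))"
  proof (rule integrable_bounded[where C="real n * (1 + p)"])
    show "\<bar>ln (?Z x)\<bar> \<le> real n * (1 + p)" for x
    proof -
      have "real n \<le> real n * (1 + p)" using p by (simp add: algebra_simps)
      then show ?thesis using ln_ge[of x] ln_le[of x] by linarith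
    qed
  qed simp
  \<comment> \<open>The trivial terms at time 0 make this literally the integrand of
    \<open>restart_mixture_ratio\<close> for k = 0.\<close>
  define g where "g x = exp (log_wealth \<alpha> 0 x - log_wealth \<alpha> (0 + n) x) * ?Z ((shift_seq ^^ 0) x)" for x
  have g_int: "integrable P g"
  proof (rule integrable_bounded[where C="exp (real n) * (exp (real n) * (1 + p) ^ n)"])
    show "\<bar>g x\<bar> \<le> exp (real n) * (exp (real n) * (1 + p) ^ n)" for x
      unfolding g_def abs_mult using pos[of x] restart_mixture_le[OF causal_\<alpha> p, of n x]
        log_wealth_bounds[OF causal_\<alpha>, of n x]
      by (intro mult_mono) auto
  qed (simp add: g_def[abs_def])
  have pw: "ln (?Z x) \<le> ?L x + real n * p + (g x / (1 + p) ^ n - 1)" for x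
  proof -
    have "ln (g x / (1 + p) ^ n) \<le> g x / (1 + p) ^ n - 1"
      using pos[of x] p by (intro ln_le_minus_one) (simp add: g_def)
    moreover have "ln (g x / (1 + p) ^ n) = - ?L x + ln (?Z x) - real n * ln (1 + p)"
      using pos[of x] p by (simp add: g_def ln_mult ln_div ln_realpow)
    moreover have "real n * ln (1 + p) \<le> real n * p"
      using ln_p by (intro mult_left_mono) auto
    ultimately show ?thesis by linarith
  qed
  have "(\<integral>x. ln (?Z x) \<partial>P) \<le> (\<integral>x. ?L x + real n * p + (g x / (1 + p) ^ n - 1) \<partial>P)"
    using int g_int log_wealth_integrable[OF causal_\<alpha>, of n] pw by (intro integral_mono) auto
  also have "\<dots> = (\<integral>x. ?L x \<partial>P) + real n * p + ((\<integral>x. g x \<partial>P) / (1 + p) ^ n - 1)"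
    using g_int log_wealth_integrable[OF causal_\<alpha>, of n] by (simp add: prob_space)
  also have "(\<integral>x. g x \<partial>P) / (1 + p) ^ n \<le> 1"
    using restart_mixture_ratio[OF p causal_\<alpha>, of 0 n] p by (simp add: g_def)
  finally show "(\<integral>x. ln (?Z x) \<partial>P) \<le> (\<integral>x. ?L x \<partial>P) + real n * p"
    by simp
qed

definition growth_rate :: real where
  "growth_rate = (SUP k. \<integral>x. log_ret \<alpha> k x \<partial>P)"

lemma log_ret_expectation_bounds: "\<bar>\<integral>x. log_ret \<alpha> k x \<partial>P\<bar> \<le> 1"
proof -
  have "\<bar>\<integral>x. log_ret \<alpha> k x \<partial>P\<bar> \<le> (\<integral>x. \<bar>log_ret \<alpha> k x\<bar> \<partial>P)"
    by (rule integral_abs_bound)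
  also have "\<dots> \<le> (\<integral>x. 1 \<partial>P)"
    using log_ret_integrable[OF causal_\<alpha>, of k] log_ret_bounds[OF causal_\<alpha>, of k]
    by (intro integral_mono) auto
  finally show ?thesis by (simp add: prob_space)
qed

lemma growth_rate_bdd: "bdd_above (range (\<lambda>k. \<integral>x. log_ret \<alpha> k x \<partial>P))"
proof (rule bdd_aboveI2)
  show "(\<integral>x. log_ret \<alpha> k x \<partial>P) \<le> 1" for k
    using log_ret_expectation_bounds[of k] by linarith
qed

lemma expected_log_wealth_le: "(\<integral>x. log_wealth \<alpha> n x \<partial>P) \<le> real n * growth_rate"
proof -
  have "(\<integral>x. log_wealth \<alpha> n x \<partial>P) = (\<Sum>t<n. \<integral>x. log_ret \<alpha> t x \<partial>P)"
    unfolding log_wealth_def by (intro Bochner_Integration.integral_sum log_ret_integrable causal_\<alpha>)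
  also have "\<dots> \<le> (\<Sum>t<n. growth_rate)"
    unfolding growth_rate_def by (intro sum_mono cSUP_upper growth_rate_bdd) simp
  finally show ?thesis by simp
qed

lemma log_wealth_upper:
  "AE x in P. \<forall>\<epsilon>>0. \<forall>\<^sub>F n in sequentially. log_wealth \<alpha> n x \<le> (growth_rate + \<epsilon>) * real n"
proof -
  \<comment> \<open>The competitor follows \<alpha> for one period and then restarts it, so its
    later log wealth is that of \<alpha> on the shifted path.\<close>
  have quasi: "AE x in P. \<forall>\<epsilon>>0. \<forall>\<^sub>F n in sequentially.
      log_wealth \<alpha> n (shift_seq x) \<le> log_wealth \<alpha> (Suc n) x + \<epsilon> * real n"
    using log_wealth_dominated[OF causal_policy_restart[OF causal_\<alpha> causal_\<alpha>, of 1]]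
  proof eventually_elim
    case (elim x)
    show ?case
    proof (intro allI impI)
      fix \<epsilon> :: real assume \<epsilon>: "0 < \<epsilon>"
      obtain n0 where n0: "\<And>n. n0 \<le> n \<Longrightarrow>
          log_wealth (restart \<alpha> 1 \<alpha>) n x \<le> log_wealth \<alpha> n x + \<epsilon> / 2 * real n"
        using elim[rule_format, of "\<epsilon> / 2"] \<epsilon> by (auto simp: eventually_sequentially)
      \<comment> \<open>Beyond \<open>n1\<close>, \<epsilon> / 2 * n absorbs the log return of the
        first period, at most 1 in modulus, and the extra \<epsilon> / 2 from
        \<open>Suc n\<close>.\<close>
      obtain n1 :: nat where n1: "(1 + \<epsilon> / 2) / (\<epsilon> / 2) \<le> real n1"
        using real_arch_simple by blast
      have "log_wealth \<alpha> n (shift_seq x) \<le> log_wealth \<alpha> (Suc n) x + \<epsilon> * real n" if n: "max n0 n1 \<le> n" for n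
      proof -
        have "(1 + \<epsilon> / 2) / (\<epsilon> / 2) \<le> real n" using n1 n by simp
        then have "1 + \<epsilon> / 2 \<le> \<epsilon> / 2 * real n" using \<epsilon> by (simp add: field_simps)
        moreover have "log_wealth \<alpha> 1 x + log_wealth \<alpha> n (shift_seq x) \<le> log_wealth \<alpha> (Suc n) x + \<epsilon> / 2 * real (Suc n)"
          using n0[of "Suc n"] n log_wealth_restart[of \<alpha> 1 \<alpha> n x] by simp
        ultimately show ?thesis
          using log_wealth_bounds[OF causal_\<alpha>, of 1 x] by (simp add: abs_le_iff field_simps)
      qed
      then show "\<forall>\<^sub>F n in sequentially. log_wealth \<alpha> n (shift_seq x) \<le> log_wealth \<alpha> (Suc n) x + \<epsilon> * real n"
        unfolding eventually_sequentially by blast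
    qed
  qed
  \<comment> \<open>With \<open>p\<close> fixed, the error - ln p is a constant \<kappa>, and only
    the rate \<open>p\<close> from the expected logarithm of the mixture remains in the
    limit.\<close>
  have main: "AE x in P. \<forall>\<epsilon>>0. \<forall>\<^sub>F n in sequentially. log_wealth \<alpha> n x \<le> (growth_rate + p + \<epsilon>) * real n"
    if p: "0 < p" "p < 1" for p
  proof (rule ergodic_upper_bound[where V="\<lambda>n x. ln (restart_mixture \<alpha> p n x)" and \<kappa>="- ln p" and C=1, OF _ _ quasi])
    have p0: "0 \<le> p" using p by simp
    note pos = restart_mixture_pos[OF causal_\<alpha> p0]
    show "random_variable borel (log_wealth \<alpha> n)" for n
      by (simp add: measurable_P log_wealth_measurable causal_\<alpha>)
    show "integrable P (\<lambda>x. ln (restart_mixture \<alpha> p n x))" for n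
      by (rule log_restart_mixture[OF p0])
    show "log_wealth \<alpha> j x - - ln p + ln (restart_mixture \<alpha> p (n - j) ((shift_seq ^^ j) x)) \<le> ln (restart_mixture \<alpha> p n x)"
      if "1 \<le> j" "j \<le> n" for n j x
    proof -
      have "ln (p * (exp (log_wealth \<alpha> j x) * restart_mixture \<alpha> p (n - j) ((shift_seq ^^ j) x))) \<le> ln (restart_mixture \<alpha> p n x)"
        using restart_mixture_super[OF causal_\<alpha> p0 that, of x] p pos by simp
      then show ?thesis
        using p by (simp add: ln_mult pos[THEN less_imp_neq[THEN not_sym]])
    qed
    show "- (1 * real n) \<le> ln (restart_mixture \<alpha> p n x)" for n x
    proof -
      have "log_wealth \<alpha> n x \<le> ln (restart_mixture \<alpha> p n x)"
        using restart_mixture_ge[OF causal_\<alpha> p0, of n x] pos by (simp add: ln_ge_iff)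
      then show ?thesis using log_wealth_bounds[OF causal_\<alpha>, of n x] by linarith
    qed
    show "- 1 \<le> log_wealth \<alpha> 1 x" for x
      using log_wealth_bounds[OF causal_\<alpha>, of 1 x] by simp
    show "0 \<le> - ln p" using p by simp
    show "(\<integral>x. ln (restart_mixture \<alpha> p n x) \<partial>P) \<le> real n * (growth_rate + p)" for n
      using log_restart_mixture(2)[OF p0, of n] expected_log_wealth_le[of n] by (simp add: algebra_simps)
  qed simp
  \<comment> \<open>The offset 2 keeps p = 1 / (m + 2) strictly below 1 even for m = 0, as
    \<open>main\<close> demands.\<close>
  have "AE x in P. \<forall>m. \<forall>\<epsilon>>0. \<forall>\<^sub>F n in sequentially. log_wealth \<alpha> n x \<le> (growth_rate + 1 / real (m + 2) + \<epsilon>) * real n"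
    unfolding AE_all_countable by (intro allI main) auto
  then show ?thesis
  proof eventually_elim
    case (elim x)
    show ?case
    proof (intro allI impI)
      fix \<epsilon> :: real assume \<epsilon>: "0 < \<epsilon>"
      then obtain m where m: "1 / real (Suc m) < \<epsilon> / 2"
        using reals_Archimedean[of "\<epsilon> / 2"] by (auto simp: inverse_eq_divide)
      have "1 / real (m + 2) \<le> 1 / real (Suc m)" by (simp add: field_simps)
      then have "growth_rate + 1 / real (m + 2) + \<epsilon> / 2 \<le> growth_rate + \<epsilon>"
        using m by linarith
      then have le: "(growth_rate + 1 / real (m + 2) + \<epsilon> / 2) * real n \<le> (growth_rate + \<epsilon>) * real n" for n
        by (intro mult_right_mono) auto
      have "\<forall>\<^sub>F n in sequentially. log_wealth \<alpha> n x \<le> (growth_rate + 1 / real (m + 2) + \<epsilon> / 2) * real n"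
        using elim[rule_format, of "\<epsilon> / 2" m] \<epsilon> by simp
      then show "\<forall>\<^sub>F n in sequentially. log_wealth \<alpha> n x \<le> (growth_rate + \<epsilon>) * real n"
        by eventually_elim (rule order_trans[OF _ le])
    qed
  qed
qed

lemma log_wealth_lower:
  "AE x in P. \<forall>\<epsilon>>0. \<forall>\<^sub>F n in sequentially. (growth_rate - \<epsilon>) * real n \<le> log_wealth \<alpha> n x"
proof -
  \<comment> \<open>The \<open>k\<close> chosen below depends on \<epsilon>, so the bounds for all
    \<open>k\<close> are collected outside one null set.\<close>
  have "AE x in P. \<forall>k. \<forall>\<epsilon>>0. \<forall>\<^sub>F n in sequentially.
      log_wealth (rolling \<alpha> k) n x \<le> log_wealth \<alpha> n x + \<epsilon> * real n"
    unfolding AE_all_countable by (intro allI log_wealth_dominated causal_policy_rolling causal_\<alpha>)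
  moreover have "AE x in P. \<forall>k. \<forall>\<epsilon>>0. \<forall>\<^sub>F n in sequentially.
      ((\<integral>x. log_ret \<alpha> k x \<partial>P) - \<epsilon>) * real n \<le> (\<Sum>i<n. log_ret \<alpha> k ((shift_seq ^^ i) x))"
    unfolding AE_all_countable
    by (intro allI birkhoff_lower_bound[where C=1]) (auto simp: measurable_P log_ret_measurable causal_\<alpha> log_ret_bounds)
  ultimately show ?thesis
  proof eventually_elim
    case (elim x)
    show ?case
    proof (intro allI impI)
      fix \<epsilon> :: real assume \<epsilon>: "0 < \<epsilon>"
      have "growth_rate - \<epsilon> / 4 < growth_rate" using \<epsilon> by simp
      then obtain k where k: "growth_rate - \<epsilon> / 4 < (\<integral>x. log_ret \<alpha> k x \<partial>P)"
        unfolding growth_rate_def using less_cSUP_iff[OF _ growth_rate_bdd] by blast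
      define g where "g = (\<integral>x. log_ret \<alpha> k x \<partial>P)"
      obtain n0 where n0: "\<And>n. n0 \<le> n \<Longrightarrow> log_wealth (rolling \<alpha> k) n x \<le> log_wealth \<alpha> n x + \<epsilon> / 4 * real n"
        using elim(1)[rule_format, of "\<epsilon> / 4" k] \<epsilon> by (auto simp: eventually_sequentially)
      obtain n1 where n1: "\<And>n. n1 \<le> n \<Longrightarrow> (g - \<epsilon> / 4) * real n \<le> (\<Sum>i<n. log_ret \<alpha> k ((shift_seq ^^ i) x))"
        using elim(2)[rule_format, of "\<epsilon> / 4" k] \<epsilon> by (auto simp: eventually_sequentially g_def)
      \<comment> \<open>This pays for the first \<open>k\<close> periods: their log wealth is at
        least - k, and the Birkhoff sum has only n - k terms. The four quarters of \<epsilon> go to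
        this, to the choice of \<open>k\<close>, to the domination and to Birkhoff's bound.\<close>
      obtain n2 :: nat where n2: "(real k + real k * \<bar>g - \<epsilon> / 4\<bar>) / (\<epsilon> / 4) \<le> real n2"
        using real_arch_simple by blast
      have "(growth_rate - \<epsilon>) * real n \<le> log_wealth \<alpha> n x" if n: "n0 + (n1 + k) + n2 \<le> n" for n
      proof -
        have "(real k + real k * \<bar>g - \<epsilon> / 4\<bar>) / (\<epsilon> / 4) \<le> real n" using n2 n by linarith
        then have 1: "real k + real k * \<bar>g - \<epsilon> / 4\<bar> \<le> \<epsilon> / 4 * real n" using \<epsilon> by (simp add: field_simps)
        have 2: "log_wealth (rolling \<alpha> k) n x = log_wealth \<alpha> k x + (\<Sum>i<n - k. log_ret \<alpha> k ((shift_seq ^^ i) x))"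
          using log_wealth_rolling[of \<alpha> k "n - k" x] n by simp
        have 3: "(g - \<epsilon> / 4) * real (n - k) \<le> (\<Sum>i<n - k. log_ret \<alpha> k ((shift_seq ^^ i) x))"
          using n by (intro n1) simp
        have 4: "(g - \<epsilon> / 4) * real (n - k) = (g - \<epsilon> / 4) * real n - real k * (g - \<epsilon> / 4)"
          using n by (simp add: of_nat_diff field_simps)
        have 5: "real k * (g - \<epsilon> / 4) \<le> real k * \<bar>g - \<epsilon> / 4\<bar>"
          by (intro mult_left_mono) auto
        have 6: "(growth_rate - \<epsilon> / 2) * real n \<le> (g - \<epsilon> / 4) * real n"
          using k by (intro mult_right_mono) (auto simp: g_def)
        have 7: "(growth_rate - \<epsilon>) * real n = (growth_rate - \<epsilon> / 2) * real n - 2 * (\<epsilon> / 4 * real n)"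
          by (simp add: algebra_simps)
        have 8: "log_wealth (rolling \<alpha> k) n x \<le> log_wealth \<alpha> n x + \<epsilon> / 4 * real n"
          using n by (intro n0) simp
        have 9: "- real k \<le> log_wealth \<alpha> k x"
          using log_wealth_bounds[OF causal_\<alpha>, of k x] by linarith
        show ?thesis using 1 2 3 4 5 6 7 8 9 by linarith
      qed
      then show "\<forall>\<^sub>F n in sequentially. (growth_rate - \<epsilon>) * real n \<le> log_wealth \<alpha> n x"
        unfolding eventually_sequentially by blast
    qed
  qed
qed

end

section \<open>Transfer to the price process\<close>

text \<open>This is the Doob-Dynkin lemma. Each set where f lies below a rational q is the preimage
  of some \<open>B q\<close>, and g is the infimum of the q with y in \<open>B q\<close>. Off the
  range of \<open>Y\<close> this infimum may be infinite, hence the detour through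
  \<open>ereal\<close>.\<close>

lemma vimage_algebra_factorization:
  fixes f :: "'a \<Rightarrow> real"
  assumes Y: "Y \<in> S \<rightarrow> space N"
    and f: "f \<in> borel_measurable (vimage_algebra S Y N)"
  obtains g where "g \<in> borel_measurable N" "\<And>\<omega>. \<omega> \<in> S \<Longrightarrow> f \<omega> = g (Y \<omega>)"
proof -
  have "\<exists>B\<in>sets N. {\<omega> \<in> S. f \<omega> < of_rat q} = Y -` B \<inter> S" for q
  proof -
    have "{\<omega> \<in> space (vimage_algebra S Y N). f \<omega> < of_rat q} \<in> sets (vimage_algebra S Y N)"
      using f by measurable
    then show ?thesis
      unfolding sets_vimage_algebra2[OF Y] by auto
  qed
  then obtain B where B: "\<And>q. B q \<in> sets N" "\<And>q. {\<omega> \<in> S. f \<omega> < of_rat q} = Y -` B q \<inter> S"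
    by metis
  note [measurable] = B(1)
  define h :: "_ \<Rightarrow> ereal" where "h y = (INF q. if y \<in> B q then ereal (of_rat q) else \<infinity>)" for y
  have "h \<in> borel_measurable N"
    unfolding h_def[abs_def] by measurable
  then have "(\<lambda>y. real_of_ereal (h y)) \<in> borel_measurable N"
    by measurable
  moreover have "f \<omega> = real_of_ereal (h (Y \<omega>))" if \<omega>: "\<omega> \<in> S" for \<omega>
  proof -
    have mem: "Y \<omega> \<in> B q \<longleftrightarrow> f \<omega> < of_rat q" for q
      using B(2)[of q] \<omega> by blast
    have "ereal (f \<omega>) \<le> h (Y \<omega>)"
      unfolding h_def mem by (rule INF_greatest) auto
    moreover have "\<not> ereal (f \<omega>) < h (Y \<omega>)"
    proof
      assume "ereal (f \<omega>) < h (Y \<omega>)"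
      then obtain r where r: "ereal (f \<omega>) < ereal r" "ereal r < h (Y \<omega>)"
        using ereal_dense2 by blast
      then obtain q where q: "f \<omega> < of_rat q" "of_rat q < r"
        using of_rat_dense[of "f \<omega>" r] by auto
      have "h (Y \<omega>) \<le> (if Y \<omega> \<in> B q then ereal (of_rat q) else \<infinity>)"
        unfolding h_def by (rule INF_lower) simp
      then have "h (Y \<omega>) \<le> ereal (of_rat q)"
        using q(1) by (simp add: mem)
      also have "\<dots> < ereal r" using q(2) by simp
      finally show False using r(2) by simp
    qed
    ultimately have "h (Y \<omega>) = ereal (f \<omega>)" by simp
    then show ?thesis by simp
  qed
  ultimately show thesis by (rule that)
qed

locale price_process = prob_space +
  fixes X :: "nat \<Rightarrow> 'a \<Rightarrow> 'n::finite \<Rightarrow> real"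
  assumes X_measurable: "\<And>t i. (\<lambda>\<omega>. X t \<omega> i) \<in> borel_measurable M"
    and X_stationary: "stationary_ergodic M X"
    and X_ret_bounds: "\<And>t \<omega> a. \<omega> \<in> space M \<Longrightarrow> a \<in> port_simplex \<Longrightarrow>
           exp (-1) \<le> ret a (X t \<omega>) \<and> ret a (X t \<omega>) \<le> exp 1"
begin

definition path :: "'a \<Rightarrow> nat \<Rightarrow> 'n \<Rightarrow> real" where
  "path \<omega> = (\<lambda>t. X t \<omega>)"

lemma path_measurable [measurable]: "path \<in> measurable M seq_space"
  by (rule measurable_into_seq_space) (simp add: path_def X_measurable)

lemma clip_path:
  assumes "\<omega> \<in> space M"
  shows "clip (path \<omega> t i) = X t \<omega> i"
proof -
  \<comment> \<open>The portfolio with all wealth in asset \<open>i\<close> returns exactly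
    \<open>X t \<omega> i\<close>, so the return bounds confine every single price relative.\<close>
  have "(\<lambda>j. if j = i then 1 else 0) \<in> port_simplex"
    by (simp add: port_simplex_def)
  from X_ret_bounds[OF assms this, of t] show ?thesis
    by (simp add: clip_def path_def ret_def if_distrib[of "\<lambda>c. c * _"] cong: if_cong)
qed

lemma past_subalgebra: "subalgebra M (past M X t)"
proof -
  have "(\<lambda>\<omega>. \<lambda>s\<in>{..<t}. X s \<omega>) \<in> measurable M (\<Pi>\<^sub>M s\<in>{..<t}. (\<Pi>\<^sub>M i\<in>UNIV. borel))"
    by (intro measurable_restrict measurable_abs_UNIV X_measurable)
  then show ?thesis
    unfolding subalgebra_def past_def by (auto dest: sets_image_in_sets[rotated])
qed

lemma past_measurable:
  assumes f: "f \<in> borel_measurable seq_space" and na: "nonanticipating t f"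
  shows "(\<lambda>\<omega>. f (path \<omega>)) \<in> borel_measurable (past M X t)"
proof -
  let ?Y = "\<lambda>\<omega>. \<lambda>s\<in>{..<t}. X s \<omega>" and ?N = "\<Pi>\<^sub>M s\<in>{..<t}. (\<Pi>\<^sub>M i\<in>(UNIV::'n set). (borel::real measure))"
  \<comment> \<open>Unseen coordinates get the default 0, which a non-anticipating \<open>f\<close>
    does not read.\<close>
  define ext where "ext y = (\<lambda>s i. if s < t then y s i else 0)" for y :: "nat \<Rightarrow> 'n \<Rightarrow> real"
  have Y: "?Y \<in> measurable (past M X t) ?N"
    unfolding past_def by (rule measurable_vimage_algebra1) (auto simp: space_PiM)
  have "ext \<in> measurable ?N seq_space"
  proof (rule measurable_into_seq_space)
    fix s i
    show "(\<lambda>y. ext y s i) \<in> borel_measurable ?N"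
    proof (cases "s < t")
      case True
      then have "(\<lambda>y. y s) \<in> measurable ?N (\<Pi>\<^sub>M i\<in>(UNIV::'n set). (borel::real measure))"
        by (intro measurable_component_singleton) simp
      then have "(\<lambda>y. y s i) \<in> borel_measurable ?N"
        by (rule measurable_compose) (rule measurable_component_singleton, simp)
      then show ?thesis using True by (simp add: ext_def)
    qed (simp add: ext_def)
  qed
  then have "(\<lambda>\<omega>. f (ext (?Y \<omega>))) \<in> borel_measurable (past M X t)"
    by (intro measurable_compose[OF Y] measurable_compose[OF _ f])
  moreover have "f (ext (?Y \<omega>)) = f (path \<omega>)" for \<omega>
    by (rule nonanticipatingD[OF na]) (simp add: ext_def path_def)
  ultimately show ?thesis by simp
qed

section \<open>Translation between admissible and causal policies\<close>

lemma admissible_of_causal: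
  assumes "causal_policy \<beta>"
  shows "admissible_policy M X (\<lambda>t \<omega>. \<beta> t (path \<omega>))"
  unfolding admissible_policy_def
proof (intro allI conjI ballI)
  fix t i \<omega>
  show "\<beta> t (path \<omega>) \<in> port_simplex"
    using assms by (simp add: causal_policy_def)
  have na: "nonanticipating t (\<beta> t)"
    using assms by (simp add: causal_policy_def)
  show "(\<lambda>\<omega>. \<beta> t (path \<omega>) i) \<in> borel_measurable (past M X t)"
    using assms nonanticipating_compose2[OF na na, of "\<lambda>b _. b i"]
    by (intro past_measurable) (auto simp: causal_policy_def)
qed

text \<open>Each portfolio coordinate factors through the first \<open>t\<close> prices. The factors
  are defined for all sequences, but off the actual price paths they may leave the simplex and have
  to be corrected there.\<close>

lemma causal_of_admissible:
  assumes A: "admissible_policy M X A"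
  obtains \<beta> where "causal_policy \<beta>" "\<And>t \<omega>. \<omega> \<in> space M \<Longrightarrow> \<beta> t (path \<omega>) = A t \<omega>"
proof -
  let ?N = "\<lambda>t. \<Pi>\<^sub>M s\<in>{..<t}. (\<Pi>\<^sub>M i\<in>(UNIV::'n set). (borel::real measure))"
  have "\<exists>g. g \<in> borel_measurable (?N t) \<and> (\<forall>\<omega>\<in>space M. A t \<omega> i = g (\<lambda>s\<in>{..<t}. X s \<omega>))" for t i
  proof -
    have "(\<lambda>\<omega>. \<lambda>s\<in>{..<t}. X s \<omega>) \<in> space M \<rightarrow> space (?N t)"
      by (auto simp: space_PiM)
    moreover have "(\<lambda>\<omega>. A t \<omega> i) \<in> borel_measurable (past M X t)"
      using A by (simp add: admissible_policy_def)
    ultimately show ?thesis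
      unfolding past_def by (rule vimage_algebra_factorization) blast
  qed
  then obtain g where g: "\<And>t i. g t i \<in> borel_measurable (?N t)"
      "\<And>t i \<omega>. \<omega> \<in> space M \<Longrightarrow> A t \<omega> i = g t i (\<lambda>s\<in>{..<t}. X s \<omega>)"
    by metis
  define b where "b t x = (\<lambda>i. g t i (restrict x {..<t}))" for t x
  \<comment> \<open>The default puts all wealth into \<open>undefined\<close>, some fixed asset.
    Whether it is used depends on \<open>b t x\<close> alone, so the policy stays
    non-anticipating.\<close>
  define \<beta> where "\<beta> t x = (if b t x \<in> port_simplex then b t x else (\<lambda>i. if i = undefined then 1 else 0))" for t x
  have b_path: "b t (path \<omega>) = A t \<omega>" if "\<omega> \<in> space M" for t \<omega>
    using g(2)[OF that] by (auto simp: b_def path_def restrict_def)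
  have b_meas [measurable]: "(\<lambda>x. b t x i) \<in> borel_measurable seq_space" for t i
  proof -
    have "(\<lambda>x. restrict x {..<t}) \<in> measurable seq_space (?N t)"
      unfolding seq_space_def by (rule measurable_restrict_subset) simp
    then show ?thesis
      unfolding b_def by (rule measurable_compose) (rule g)
  qed
  have "causal_policy \<beta>"
    unfolding causal_policy_def
  proof (intro allI conjI)
    fix t x i
    show "\<beta> t x \<in> port_simplex"
      by (auto simp: \<beta>_def port_simplex_def)
    have "Measurable.pred seq_space (\<lambda>x. b t x \<in> port_simplex)"
      unfolding port_simplex_def mem_Collect_eq by measurable
    then have "(\<lambda>x. if b t x \<in> port_simplex then b t x i else (if i = undefined then 1 else 0)) \<in> borel_measurable seq_space"
      by measurable
    moreover have "\<beta> t x i = (if b t x \<in> port_simplex then b t x i else (if i = undefined then 1 else 0))" for x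
      by (simp add: \<beta>_def)
    ultimately show "(\<lambda>x. \<beta> t x i) \<in> borel_measurable seq_space" by simp
    show "nonanticipating t (\<beta> t)"
      unfolding nonanticipating_def
    proof (intro allI impI)
      fix x y :: "nat \<Rightarrow> 'n \<Rightarrow> real" assume "\<forall>s<t. x s = y s"
      then have "restrict x {..<t} = restrict y {..<t}"
        by (intro restrict_ext) auto
      then show "\<beta> t x = \<beta> t y"
        by (simp add: \<beta>_def b_def)
    qed
  qed
  moreover have "\<beta> t (path \<omega>) = A t \<omega>" if "\<omega> \<in> space M" for t \<omega>
    using A that by (simp add: \<beta>_def b_path admissible_policy_def)
  ultimately show thesis by (rule that)
qed

lemma log_ret_path:
  assumes "\<omega> \<in> space M" "\<beta> t (path \<omega>) = A t \<omega>"
  shows "log_ret \<beta> t (path \<omega>) = ln (ret (A t \<omega>) (X t \<omega>))"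
  using assms by (simp add: log_ret_def clip_path)

lemma log_wealth_path:
  assumes \<omega>: "\<omega> \<in> space M" and A: "admissible_policy M X A"
    and eq: "\<And>t. \<beta> t (path \<omega>) = A t \<omega>"
  shows "log_wealth \<beta> n (path \<omega>) = ln (wealth X A n \<omega>)"
proof -
  have "ret (A t \<omega>) (X t \<omega>) \<noteq> 0" for t
    using X_ret_bounds[OF \<omega>, of "A t \<omega>" t] A \<omega> exp_gt_zero[of "-1::real"]
    unfolding admissible_policy_def by (metis not_less)
  then show ?thesis
    unfolding log_wealth_def wealth_def
    by (subst ln_prod) (auto simp: log_ret_path[where A=A and \<beta>=\<beta>, OF \<omega>] eq)
qed

text \<open>Along the path, \<open>W\<close> is measurable with respect to the past, so under the
  integral \<open>u\<close> and \<open>v\<close> may be replaced by their conditional expectations.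
  The almost sure comparison then integrates.\<close>

lemma weighted_cond_exp_le:
  assumes W: "weight t W"
    and u [measurable]: "u \<in> borel_measurable M" and ub: "\<And>\<omega>. \<omega> \<in> space M \<Longrightarrow> \<bar>u \<omega>\<bar> \<le> 1"
    and v [measurable]: "v \<in> borel_measurable M" and vb: "\<And>\<omega>. \<omega> \<in> space M \<Longrightarrow> \<bar>v \<omega>\<bar> \<le> 1"
    and le: "AE \<omega> in M. real_cond_exp M (past M X t) u \<omega> \<le> real_cond_exp M (past M X t) v \<omega> + c"
  shows "(\<integral>\<omega>. W (path \<omega>) * (u \<omega> - v \<omega> - c) \<partial>M) \<le> 0"
proof -
  interpret F: finite_measure_subalgebra M "past M X t"
    by unfold_locales (rule past_subalgebra)
  obtain C where C: "\<And>x. W x \<le> C" and W0: "\<And>x. 0 \<le> W x"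
    and Wm [measurable]: "W \<in> borel_measurable seq_space" and na: "nonanticipating t W"
    using W by (auto simp: weight_def)
  define w where "w \<omega> = W (path \<omega>)" for \<omega>
  have wF: "w \<in> borel_measurable (past M X t)"
    unfolding w_def[abs_def] by (rule past_measurable[OF Wm na])
  have [measurable]: "w \<in> borel_measurable M"
    unfolding w_def[abs_def] by measurable
  have w_int: "integrable M w"
    by (rule integrable_const_bound[where B=C]) (auto simp: w_def W0 C)
  have wf_int: "integrable M (\<lambda>\<omega>. w \<omega> * f \<omega>)"
    if [measurable]: "f \<in> borel_measurable M" and "\<And>\<omega>. \<omega> \<in> space M \<Longrightarrow> \<bar>f \<omega>\<bar> \<le> 1" for f
  proof (rule integrable_const_bound[where B="C * 1"])
    show "AE \<omega> in M. norm (w \<omega> * f \<omega>) \<le> C * 1"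
      using that(2) C W0 unfolding w_def
      by (intro AE_I2) (auto simp only: real_norm_def abs_mult intro!: mult_mono order_trans[OF W0 C], simp)
  qed simp
  note u_int = wf_int[OF u ub] and v_int = wf_int[OF v vb]
  note cu = F.real_cond_exp_intg[OF u_int wF u] and cv = F.real_cond_exp_intg[OF v_int wF v]
  have "(\<integral>\<omega>. w \<omega> * u \<omega> \<partial>M) = (\<integral>\<omega>. w \<omega> * real_cond_exp M (past M X t) u \<omega> \<partial>M)"
    by (simp add: cu(2))
  also have "\<dots> \<le> (\<integral>\<omega>. w \<omega> * real_cond_exp M (past M X t) v \<omega> + c * w \<omega> \<partial>M)"
  proof (rule integral_mono_AE)
    show "AE \<omega> in M. w \<omega> * real_cond_exp M (past M X t) u \<omega> \<le> w \<omega> * real_cond_exp M (past M X t) v \<omega> + c * w \<omega>"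
      using le
    proof eventually_elim
      case (elim \<omega>)
      then have "w \<omega> * real_cond_exp M (past M X t) u \<omega> \<le> w \<omega> * (real_cond_exp M (past M X t) v \<omega> + c)"
        by (intro mult_left_mono) (auto simp: w_def W0)
      then show ?case by (simp add: algebra_simps)
    qed
  qed (use cu(1) cv(1) w_int in auto)
  also have "\<dots> = (\<integral>\<omega>. w \<omega> * v \<omega> \<partial>M) + c * (\<integral>\<omega>. w \<omega> \<partial>M)"
    using cv w_int by simp
  finally have "(\<integral>\<omega>. w \<omega> * u \<omega> - w \<omega> * v \<omega> - c * w \<omega> \<partial>M) \<le> 0"
    using u_int v_int w_int by simp
  then show ?thesis
    by (simp add: w_def algebra_simps)
qed

lemma integral_weighted_path:
  assumes W: "weight t W" and \<beta>: "causal_policy \<beta>" and \<gamma>: "causal_policy \<gamma>"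
  shows "(\<integral>x. W x * (log_ret \<beta> t x - log_ret \<gamma> t x - c) \<partial>(distr M seq_space path))
    = (\<integral>\<omega>. W (path \<omega>) * (log_ret \<beta> t (path \<omega>) - log_ret \<gamma> t (path \<omega>) - c) \<partial>M)"
proof (rule integral_distr)
  have [measurable]: "log_ret \<beta> t \<in> borel_measurable seq_space" "log_ret \<gamma> t \<in> borel_measurable seq_space"
      "W \<in> borel_measurable seq_space"
    using W by (auto simp: weight_def log_ret_measurable \<beta> \<gamma>)
  show "(\<lambda>x. W x * (log_ret \<beta> t x - log_ret \<gamma> t x - c)) \<in> borel_measurable seq_space"
    by measurable
qed simp

lemma real_cond_exp_bounds:
  assumes [measurable]: "f \<in> borel_measurable M" and b: "\<And>\<omega>. \<omega> \<in> space M \<Longrightarrow> l \<le> f \<omega> \<and> f \<omega> \<le> h"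
  shows "AE \<omega> in M. l \<le> real_cond_exp M (past M X t) f \<omega> \<and> real_cond_exp M (past M X t) f \<omega> \<le> h"
proof -
  interpret F: finite_measure_subalgebra M "past M X t"
    by unfold_locales (rule past_subalgebra)
  have "integrable M f"
    by (rule integrable_const_bound[where B="\<bar>l\<bar> + \<bar>h\<bar>"]) (use b in \<open>auto simp: abs_le_iff dest!: b\<close>)
  then show ?thesis
    using F.real_cond_exp_ge_c[of f l] F.real_cond_exp_le_c[of f h] b by auto
qed

lemma period_log_return:
  assumes A: "admissible_policy M X A"
  shows period_measurable: "(\<lambda>\<omega>. ln (ret (A t \<omega>) (X t \<omega>))) \<in> borel_measurable M"
    and period_bounds: "\<omega> \<in> space M \<Longrightarrow> \<bar>ln (ret (A t \<omega>) (X t \<omega>))\<bar> \<le> 1"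
proof -
  have [measurable]: "(\<lambda>\<omega>. A t \<omega> i) \<in> borel_measurable M" for i
    using A by (intro measurable_from_subalg[OF past_subalgebra[of t]]) (simp add: admissible_policy_def)
  note X_measurable [measurable]
  show "(\<lambda>\<omega>. ln (ret (A t \<omega>) (X t \<omega>))) \<in> borel_measurable M"
    unfolding ret_def by measurable
next
  assume \<omega>: "\<omega> \<in> space M"
  have b: "exp (-1) \<le> ret (A t \<omega>) (X t \<omega>)" "ret (A t \<omega>) (X t \<omega>) \<le> exp 1"
    using X_ret_bounds[OF \<omega>, of "A t \<omega>" t] A \<omega> by (auto simp: admissible_policy_def)
  moreover have "0 < ret (A t \<omega>) (X t \<omega>)"
    using b(1) exp_gt_zero[of "-1::real"] by linarith
  ultimately have "- 1 \<le> ln (ret (A t \<omega>) (X t \<omega>))" "ln (ret (A t \<omega>) (X t \<omega>)) \<le> 1"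
    using ln_le_cancel_iff[of "exp (-1)" "ret (A t \<omega>) (X t \<omega>)"] ln_le_cancel_iff[of "ret (A t \<omega>) (X t \<omega>)" "exp 1"]
    by auto
  then show "\<bar>ln (ret (A t \<omega>) (X t \<omega>))\<bar> \<le> 1" by simp
qed

lemma mv_optimal_cond_mean:
  assumes A: "mv_optimal M X lam A" and B: "admissible_policy M X B" and lam: "0 \<le> lam"
  shows "AE \<omega> in M. cond_mean_log M X B t \<omega> \<le> cond_mean_log M X A t \<omega> + 9 / 4 * lam"
proof -
  have A': "admissible_policy M X A" using A by (simp add: mv_optimal_def)
  have mean: "AE \<omega> in M. \<bar>cond_mean_log M X A t \<omega>\<bar> \<le> 1"
    unfolding cond_mean_log_def
    using real_cond_exp_bounds[OF period_measurable[OF A', of t], of "-1" 1 t] period_bounds[OF A', of _ t]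
    by (auto simp: abs_le_iff)
  have square: "AE \<omega> in M. 0 \<le> real_cond_exp M (past M X t) (\<lambda>\<omega>. (ln (ret (C t \<omega>) (X t \<omega>)))\<^sup>2) \<omega>
      \<and> real_cond_exp M (past M X t) (\<lambda>\<omega>. (ln (ret (C t \<omega>) (X t \<omega>)))\<^sup>2) \<omega> \<le> 1"
    if C: "admissible_policy M X C" for C
    by (rule real_cond_exp_bounds)
      (use period_measurable[OF C, of t] period_bounds[OF C, of _ t] in \<open>auto simp: abs_square_le_1\<close>)
  have "AE \<omega> in M. cond_mean_log M X B t \<omega> - lam * cond_var_log M X B t \<omega>
      \<le> cond_mean_log M X A t \<omega> - lam * cond_var_log M X A t \<omega>"
    using A B by (simp add: mv_optimal_def)
  then show ?thesis
    using mean square[OF A'] square[OF B]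
  proof eventually_elim
    case (elim \<omega>)
    have "(cond_mean_log M X A t \<omega>)\<^sup>2 \<le> 1"
      using elim(2) by (simp add: abs_square_le_1)
    moreover have "0 \<le> (cond_mean_log M X B t \<omega>)\<^sup>2" by simp
    \<comment> \<open>Log returns lie in [-1, 1], so the second moment for \<open>B\<close> and the
      squared mean for \<open>A\<close> are each at most 1, and the other two terms have the
      favourable sign. The sum 2 is below 9 / 4.\<close>
    ultimately have "cond_var_log M X B t \<omega> - cond_var_log M X A t \<omega> \<le> 9 / 4"
      using elim(3,4) unfolding cond_var_log_def by linarith
    then have "lam * (cond_var_log M X B t \<omega> - cond_var_log M X A t \<omega>) \<le> lam * (9 / 4)"
      by (intro mult_left_mono lam)
    then show ?case
      using elim(1) by (simp add: algebra_simps)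
  qed
qed

text \<open>This passes from conditional means on \<open>M\<close> to the integrated form on the
  sequence space. It is used with c = 0 for log-optimality and with c = 9 / 4 * lam for
  mean-variance optimality.\<close>

lemma weighted_log_ret_le:
  assumes A: "admissible_policy M X A" and \<alpha>: "causal_policy \<alpha>" "\<And>t \<omega>. \<omega> \<in> space M \<Longrightarrow> \<alpha> t (path \<omega>) = A t \<omega>"
    and B: "admissible_policy M X B" and \<beta>: "causal_policy \<beta>" "\<And>t \<omega>. \<omega> \<in> space M \<Longrightarrow> \<beta> t (path \<omega>) = B t \<omega>"
    and W: "weight t W"
    and le: "AE \<omega> in M. cond_mean_log M X B t \<omega> \<le> cond_mean_log M X A t \<omega> + c"
  shows "(\<integral>x. W x * (log_ret \<beta> t x - log_ret \<alpha> t x - c) \<partial>(distr M seq_space path)) \<le> 0"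
proof -
  have "(\<integral>x. W x * (log_ret \<beta> t x - log_ret \<alpha> t x - c) \<partial>(distr M seq_space path))
      = (\<integral>\<omega>. W (path \<omega>) * (ln (ret (B t \<omega>) (X t \<omega>)) - ln (ret (A t \<omega>) (X t \<omega>)) - c) \<partial>M)"
    unfolding integral_weighted_path[OF W \<beta>(1) \<alpha>(1)]
    by (rule Bochner_Integration.integral_cong) (simp_all add: log_ret_path \<alpha>(2) \<beta>(2))
  also have "\<dots> \<le> 0"
    using le unfolding cond_mean_log_def
    by (intro weighted_cond_exp_le[OF W] period_measurable period_bounds A B)
  finally show ?thesis .
qed

lemma ergodic_path: "ergodic_system (distr M seq_space path) shift_seq"
proof -
  let ?P = "distr M seq_space path"
  have shift: "shift_seq \<in> measurable seq_space seq_space"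
    using measurable_funpow_shift[of 1] by simp
  interpret P: prob_space ?P
    by (rule prob_space_distr) simp
  show ?thesis
  proof unfold_locales
    show "shift_seq \<in> measurable ?P ?P"
      using shift by simp
    have "distr ?P ?P shift_seq = distr ?P seq_space shift_seq"
      by (rule distr_cong) auto
    also have "\<dots> = distr M seq_space (\<lambda>\<omega>. shift_seq (path \<omega>))"
      using shift by (subst distr_distr) (auto simp: comp_def)
    also have "\<dots> = ?P"
      using X_stationary by (simp add: stationary_ergodic_def path_def[abs_def])
    finally show "distr ?P ?P shift_seq = ?P" .
    fix A assume A: "A \<in> sets ?P" "shift_seq -` A \<inter> space ?P = A"
    then have "measure M (path -` A \<inter> space M) \<in> {0, 1}"
      using X_stationary by (simp add: stationary_ergodic_def path_def[abs_def])
    then show "P.prob A \<in> {0, 1}"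
      using A by (simp add: measure_distr)
  qed
qed

end

section \<open>Limits from eventual linear bounds\<close>

lemma liminf_growth_bounds:
  fixes u v :: "nat \<Rightarrow> real"
  assumes upper: "\<forall>\<epsilon>>0. \<forall>\<^sub>F n in sequentially. u n \<le> (w + \<epsilon>) * real n"
    and lower: "\<forall>\<epsilon>>0. \<forall>\<^sub>F n in sequentially. (w - \<epsilon>) * real n \<le> u n"
    and v_le: "\<forall>\<epsilon>>0. \<forall>\<^sub>F n in sequentially. v n \<le> u n + \<epsilon> * real n"
    and v_ge: "\<forall>\<epsilon>>0. \<forall>\<^sub>F n in sequentially. u n - v n - c * real n \<le> \<epsilon> * real n"
  shows "(\<lambda>n. u n / real n) \<longlonglongrightarrow> w"
    and "liminf (\<lambda>n. ereal (v n / real n)) \<le> ereal w"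
    and "ereal (w - c) \<le> liminf (\<lambda>n. ereal (v n / real n))"
proof -
  show "(\<lambda>n. u n / real n) \<longlonglongrightarrow> w"
  proof (rule tendstoI)
    fix \<epsilon> :: real assume "0 < \<epsilon>"
    then have "0 < \<epsilon> / 2" by simp
    from upper[rule_format, OF this] lower[rule_format, OF this] eventually_gt_at_top[of 0]
    show "\<forall>\<^sub>F n in sequentially. dist (u n / real n) w < \<epsilon>"
    proof eventually_elim
      case (elim n)
      then have "u n / real n \<le> w + \<epsilon> / 2" "w - \<epsilon> / 2 \<le> u n / real n"
        by (auto simp: pos_divide_le_eq pos_le_divide_eq)
      then show ?case
        using \<open>0 < \<epsilon>\<close> unfolding dist_real_def by linarith
    qed
  qed
  show "liminf (\<lambda>n. ereal (v n / real n)) \<le> ereal w"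
  proof (rule ereal_le_epsilon2)
    fix \<epsilon> :: real assume "0 < \<epsilon>"
    then have "0 < \<epsilon> / 2" by simp
    from upper[rule_format, OF this] v_le[rule_format, OF this] eventually_gt_at_top[of 0]
    have "\<forall>\<^sub>F n in sequentially. ereal (v n / real n) \<le> ereal (w + \<epsilon>)"
    proof eventually_elim
      case (elim n)
      then have "v n \<le> (w + \<epsilon>) * real n" by (simp add: algebra_simps)
      then show ?case using elim by (simp add: pos_divide_le_eq)
    qed
    then have "limsup (\<lambda>n. ereal (v n / real n)) \<le> ereal (w + \<epsilon>)"
      by (rule Limsup_bounded)
    then show "liminf (\<lambda>n. ereal (v n / real n)) \<le> ereal w + ereal \<epsilon>"
      using Liminf_le_Limsup[of sequentially "\<lambda>n. ereal (v n / real n)"] by simp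
  qed
  show "ereal (w - c) \<le> liminf (\<lambda>n. ereal (v n / real n))"
  proof (rule ereal_le_epsilon2)
    fix \<epsilon> :: real assume "0 < \<epsilon>"
    then have "0 < \<epsilon> / 2" by simp
    from lower[rule_format, OF this] v_ge[rule_format, OF this] eventually_gt_at_top[of 0]
    have "\<forall>\<^sub>F n in sequentially. ereal (w - c - \<epsilon>) \<le> ereal (v n / real n)"
    proof eventually_elim
      case (elim n)
      then have "(w - c - \<epsilon>) * real n \<le> v n" by (simp add: algebra_simps)
      then show ?case using elim by (simp add: pos_le_divide_eq)
    qed
    then have "ereal (w - c - \<epsilon>) \<le> liminf (\<lambda>n. ereal (v n / real n))"
      by (rule Liminf_bounded)
    then have "ereal (w - c - \<epsilon>) + ereal \<epsilon> \<le> liminf (\<lambda>n. ereal (v n / real n)) + ereal \<epsilon>"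
      by (rule add_right_mono)
    then show "ereal (w - c) \<le> liminf (\<lambda>n. ereal (v n / real n)) + ereal \<epsilon>"
      by simp
  qed
qed

theorem theorem1:
  fixes M :: "'a measure" and X :: "nat \<Rightarrow> 'a \<Rightarrow> 'n::finite \<Rightarrow> real" and cash :: 'n
    and lam :: real and A Astar :: "nat \<Rightarrow> 'a \<Rightarrow> 'n \<Rightarrow> real"
  assumes "prob_space M"
    and "\<And>t i. (\<lambda>\<omega>. X t \<omega> i) \<in> borel_measurable M"
    and "\<And>t \<omega> i. \<omega> \<in> space M \<Longrightarrow> 0 \<le> X t \<omega> i"
    and "\<And>t \<omega>. \<omega> \<in> space M \<Longrightarrow> X t \<omega> cash = 1"
    and "stationary_ergodic M X"
    and "\<And>t \<omega> a. \<omega> \<in> space M \<Longrightarrow> a \<in> port_simplex \<Longrightarrow>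
           exp (-1) \<le> ret a (X t \<omega>) \<and> ret a (X t \<omega>) \<le> exp 1"
    and "0 \<le> lam"
    and "log_optimal M X Astar"
    and "mv_optimal M X lam A"
  shows "\<exists>W::real. AE \<omega> in M.
           (\<lambda>n. ln (wealth X Astar n \<omega>) / real n) \<longlonglongrightarrow> W \<and>
           liminf (\<lambda>n. ereal (ln (wealth X A n \<omega>) / real n)) \<le> ereal W \<and>
           ereal (W - 9/4 * lam) \<le> liminf (\<lambda>n. ereal (ln (wealth X A n \<omega>) / real n))"
proof -
  interpret prob_space M by fact
  interpret price_process M X
    by unfold_locales (use assms in auto)
  have admS: "admissible_policy M X Astar" and admA: "admissible_policy M X A"
    using assms by (auto simp: log_optimal_def mv_optimal_def)
  obtain \<alpha> where \<alpha>: "causal_policy \<alpha>" "\<And>t \<omega>. \<omega> \<in> space M \<Longrightarrow> \<alpha> t (path \<omega>) = Astar t \<omega>"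
    using causal_of_admissible[OF admS] by blast
  obtain \<beta> where \<beta>: "causal_policy \<beta>" "\<And>t \<omega>. \<omega> \<in> space M \<Longrightarrow> \<beta> t (path \<omega>) = A t \<omega>"
    using causal_of_admissible[OF admA] by blast
  let ?P = "distr M seq_space path"
  interpret S: ergodic_system ?P shift_seq by (rule ergodic_path)
  \<comment> \<open>Composition with \<open>path\<close> turns every causal policy into an
    admissible competitor, so log-optimality on \<open>M\<close> yields the assumption
    \<open>optimal\<close>.\<close>
  interpret market ?P \<alpha>
  proof unfold_locales
    show "sets ?P = sets seq_space" by simp
    show "causal_policy \<alpha>" by (rule \<alpha>)
    fix \<gamma> :: "nat \<Rightarrow> (nat \<Rightarrow> 'n \<Rightarrow> real) \<Rightarrow> 'n \<Rightarrow> real" and t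
      and W :: "(nat \<Rightarrow> 'n \<Rightarrow> real) \<Rightarrow> real"
    assume \<gamma>: "causal_policy \<gamma>" and W: "weight t W"
    note adm = admissible_of_causal[OF \<gamma>]
    have "AE \<omega> in M. cond_mean_log M X (\<lambda>t \<omega>. \<gamma> t (path \<omega>)) t \<omega> \<le> cond_mean_log M X Astar t \<omega> + 0"
      using assms(8) adm by (simp add: log_optimal_def)
    have "(\<integral>x. W x * (log_ret \<gamma> t x - log_ret \<alpha> t x - 0) \<partial>?P) \<le> 0"
      by (rule weighted_log_ret_le[OF admS \<alpha> adm \<gamma> _ W]) (simp_all only: refl, fact)
    then show "(\<integral>x. W x * (log_ret \<gamma> t x - log_ret \<alpha> t x) \<partial>?P) \<le> 0" by simp
  qed
  \<comment> \<open>Here the log-optimal policy is the competitor: its excess over the mean-variance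
    optimal one has nonpositive conditional mean once 9 / 4 * lam is subtracted in each
    period.\<close>
  have v_ge: "AE x in ?P. \<forall>\<epsilon>>0. \<forall>\<^sub>F n in sequentially.
      (\<Sum>t<n. log_ret \<alpha> t x - log_ret \<beta> t x - 9 / 4 * lam) \<le> \<epsilon> * real n"
  proof (rule supermartingale_growth[where K="2 + 9 / 4 * lam"])
    show "(\<lambda>x. log_ret \<alpha> t x - log_ret \<beta> t x - 9 / 4 * lam) \<in> borel_measurable seq_space" for t
      using log_ret_measurable[OF \<alpha>(1)] log_ret_measurable[OF \<beta>(1)] by measurable
    show "nonanticipating (Suc t) (\<lambda>x. log_ret \<alpha> t x - log_ret \<beta> t x - 9 / 4 * lam)" for t
      by (rule nonanticipating_compose2[OF log_ret_nonanticipating[OF \<alpha>(1)] log_ret_nonanticipating[OF \<beta>(1)]])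
    show "\<bar>log_ret \<alpha> t x - log_ret \<beta> t x - 9 / 4 * lam\<bar> \<le> 2 + 9 / 4 * lam" for t x
      using log_ret_bounds[OF \<alpha>(1), of t x] log_ret_bounds[OF \<beta>(1), of t x] assms(7) by linarith
    show "0 < 2 + 9 / 4 * lam" using assms(7) by simp
    show "(\<integral>x. W x * (log_ret \<alpha> t x - log_ret \<beta> t x - 9 / 4 * lam) \<partial>?P) \<le> 0" if "weight t W" for t W
      by (rule weighted_log_ret_le[OF admA \<beta> admS \<alpha> that mv_optimal_cond_mean[OF assms(9) admS assms(7)]])
  qed
  have "AE x in ?P.
      (\<lambda>n. log_wealth \<alpha> n x / real n) \<longlonglongrightarrow> growth_rate \<and>
      liminf (\<lambda>n. ereal (log_wealth \<beta> n x / real n)) \<le> ereal growth_rate \<and>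
      ereal (growth_rate - 9/4 * lam) \<le> liminf (\<lambda>n. ereal (log_wealth \<beta> n x / real n))"
    using log_wealth_upper log_wealth_lower log_wealth_dominated[OF \<beta>(1)] v_ge
  proof eventually_elim
    case (elim x)
    have "\<forall>\<epsilon>>0. \<forall>\<^sub>F n in sequentially. log_wealth \<alpha> n x - log_wealth \<beta> n x - 9 / 4 * lam * real n \<le> \<epsilon> * real n"
      using elim(4) by (simp add: log_wealth_def sum_subtractf mult.commute)
    from liminf_growth_bounds[OF elim(1-3) this] show ?case by blast
  qed
  \<comment> \<open>Null sets of the path law pull back to \<open>M\<close>, and on actual paths the
    log wealth from clipped prices is the true one.\<close>
  from AE_distrD[OF path_measurable this] AE_space
  have "AE \<omega> in M.
      (\<lambda>n. ln (wealth X Astar n \<omega>) / real n) \<longlonglongrightarrow> growth_rate \<and>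
      liminf (\<lambda>n. ereal (ln (wealth X A n \<omega>) / real n)) \<le> ereal growth_rate \<and>
      ereal (growth_rate - 9/4 * lam) \<le> liminf (\<lambda>n. ereal (ln (wealth X A n \<omega>) / real n))"
  proof eventually_elim
    case (elim \<omega>)
    have "log_wealth \<alpha> n (path \<omega>) = ln (wealth X Astar n \<omega>)"
        "log_wealth \<beta> n (path \<omega>) = ln (wealth X A n \<omega>)" for n
      by (intro log_wealth_path elim(2) admS admA \<alpha>(2) \<beta>(2))+
    then show ?case
      using elim(1) by simp
  qed
  then show ?thesis by blast
qed

end
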